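(* Let $\mathfrak g$ be an $I$-central Gårding-Dirichlet polynomial of degree $N$ on $\mathcal S(n)$, with Gårding cone $\Gamma$. Then the inequality $$\mathfrak g(A)^{1/N} \ \geq\ \mathfrak g(I)^{1/N}(\det A)^{1/n}\qquad\text{for all } A\in\mathcal S(n),\ A>0$$ is equivalent to the statement $$D_B\,\mathfrak g^{1/N}>0\quad\text{and}\quad \det\left(D_B\,\mathfrak g^{1/N}\right)\ \geq\ \frac{\mathfrak g(I)^{n/N}}{n^n}\qquad\text{for all } B\in\Gamma,$$ and consequently the latter statement holds.
   Context: $\mathcal S(n)$ denotes the vector space of $n\times n$ real symmetric matrices, with inner product $\langle A,B\rangle=\mathrm{tr}(AB)$; $I$ is the identity matrix; $A>0$ means $A$ is positive definite. For a function $F$ differentiable at $B\in\mathcal S(n)$, $D_BF\in\mathcal S(n)$ denotes the gradient of $F$ at $B$ with respect to this inner product. Let $\mathfrak g$ be a real homogeneous polynomial of degree $N$ on $\mathcal S(n)$. It is $I$-hyperbolic if $\mathfrak g(I)>0$ and, for each $A\in\mathcal S(n)$, the polynomial $t\mapsto \mathfrak g(tI+A)$ has only real roots. In that case its Gårding cone $\Gamma$ is the connected component of $\{\mathfrak g>0\}$ containing $I$. An $I$-hyperbolic $\mathfrak g$ is a Gårding-Dirichlet polynomial if $\Gamma$ contains $\{A\in\mathcal S(n): A>0\}$. The polynomial $\mathfrak g$ is $I$-central if $D_I\mathfrak g=kI$ for some real $k>0$. *)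

theory Defs
  imports "HOL-Analysis.Analysis" "HOL-Computational_Algebra.Polynomial"
begin

definition sym_mats :: "(real^'n^'n) set" where
  "sym_mats = {A. transpose A = A}"

definition pos_def :: "real^'n^'n \<Rightarrow> bool" where
  "pos_def A \<longleftrightarrow> A \<in> sym_mats \<and> (\<forall>x. x \<noteq> 0 \<longrightarrow> 0 < x \<bullet> (A *v x))"

text \<open>
  Functions on the space of symmetric matrices are represented by functions on all square
  matrices, of which only the values on \<^const>\<open>sym_mats\<close> matter; derivatives are accordingly
  taken within \<^const>\<open>sym_mats\<close>. Such a derivative does not determine a matrix \<open>D\<close>
  in the ambient space, but it does determine a symmetric one (see the lemma below).
\<close>

definition has_sym_gradient ::
  "(real^'n^'n \<Rightarrow> real) \<Rightarrow> real^'n^'n \<Rightarrow> real^'n^'n \<Rightarrow> bool" where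
  "has_sym_gradient F D B \<longleftrightarrow> B \<in> sym_mats \<and> D \<in> sym_mats \<and>
     (F has_derivative (\<lambda>H. trace (D ** H))) (at B within sym_mats)"

lemma has_sym_gradient_unique:
  fixes F :: "real^'n^'n \<Rightarrow> real"
  assumes "has_sym_gradient F D B" and "has_sym_gradient F E B"
  shows "D = E"
proof -
  have B: "transpose B = B" and D: "transpose D = D" and E: "transpose E = E"
    using assms by (auto simp: has_sym_gradient_def sym_mats_def)
  define H where "H = D - E"
  have tr: "transpose (X + c *\<^sub>R Y) = transpose X + c *\<^sub>R transpose Y"
    for X Y :: "real^'n^'n" and c
    by (simp add: transpose_def vec_eq_iff)
  have H: "transpose H = H"
    using tr[of D "-1" E] D E by (simp add: H_def)
  have line: "((\<lambda>t. F (B + t *\<^sub>R H)) has_derivative (\<lambda>t. trace (G ** (t *\<^sub>R H)))) (at 0)"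
    if "has_sym_gradient F G B" for G
  proof -
    have sub: "range (\<lambda>t. B + t *\<^sub>R H) \<subseteq> sym_mats"
      using B H by (auto simp: sym_mats_def tr)
    have "((\<lambda>t. B + t *\<^sub>R H) has_derivative (\<lambda>t. t *\<^sub>R H)) (at 0)"
      by (auto intro!: derivative_eq_intros)
    moreover have "(F has_derivative (\<lambda>H. trace (G ** H)))
        (at (B + 0 *\<^sub>R H) within range (\<lambda>t. B + t *\<^sub>R H))"
      using that sub by (auto simp: has_sym_gradient_def intro: has_derivative_subset)
    ultimately show ?thesis
      by (rule has_derivative_in_compose)
  qed
  have "trace (D ** (1 *\<^sub>R H)) = trace (E ** (1 *\<^sub>R H))"
    using has_derivative_unique[OF line[OF assms(1)] line[OF assms(2)]] by metis
  then have "trace (H ** H) = 0"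
    by (simp add: H_def trace_def matrix_matrix_mult_def sum_subtractf sum.distrib algebra_simps)
  moreover have "trace (H ** H) = H \<bullet> H"
  proof -
    have "H $ i $ j = H $ j $ i" for i j
      using H by (metis transpose_def vec_lambda_beta)
    then show ?thesis
      by (simp add: trace_def matrix_matrix_mult_def inner_vec_def)
  qed
  ultimately show "D = E"
    by (simp add: H_def)
qed

definition homogeneous_polynomial :: "nat \<Rightarrow> (real^'n^'n \<Rightarrow> real) \<Rightarrow> bool" where
  "homogeneous_polynomial N g \<longleftrightarrow>
     (\<exists>p. real_polynomial_function p \<and> (\<forall>A\<in>sym_mats. g A = p A)) \<and>
     (\<forall>A\<in>sym_mats. \<forall>t. g (t *\<^sub>R A) = t ^ N * g A)"

text \<open>
  That all roots of \<open>t \<mapsto> g (tI + A)\<close> are real is a statement about its complex roots,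
  hence about the (unique) formal polynomial inducing this function.
\<close>

definition I_hyperbolic :: "nat \<Rightarrow> (real^'n^'n \<Rightarrow> real) \<Rightarrow> bool" where
  "I_hyperbolic N g \<longleftrightarrow> homogeneous_polynomial N g \<and> 0 < g (mat 1) \<and>
     (\<forall>A\<in>sym_mats. \<exists>p :: real poly. (\<forall>t. poly p t = g (t *\<^sub>R mat 1 + A)) \<and>
        (\<forall>z :: complex. poly (map_poly of_real p) z = 0 \<longrightarrow> z \<in> \<real>))"

definition garding_cone :: "(real^'n^'n \<Rightarrow> real) \<Rightarrow> (real^'n^'n) set" where
  "garding_cone g = connected_component_set {A \<in> sym_mats. 0 < g A} (mat 1)"

definition garding_dirichlet :: "nat \<Rightarrow> (real^'n^'n \<Rightarrow> real) \<Rightarrow> bool" where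
  "garding_dirichlet N g \<longleftrightarrow> I_hyperbolic N g \<and> {A. pos_def A} \<subseteq> garding_cone g"

definition I_central :: "(real^'n^'n \<Rightarrow> real) \<Rightarrow> bool" where
  "I_central g \<longleftrightarrow> (\<exists>k>0. has_sym_gradient g (k *\<^sub>R mat 1) (mat 1))"

end

theory Submission
  imports Defs "HOL-Complex_Analysis.Complex_Analysis"
    "HOL-Computational_Algebra.Fundamental_Theorem_Algebra"
begin

text \<open>
  Garding's argument shows that \<open>g\<close> is hyperbolic along every \<open>a\<close> in its cone: for real
  \<open>y\<close> and \<open>\<alpha> > 0\<close> the roots \<open>t\<close> of \<open>g (\<i>\<alpha>I + ta + sy)\<close> never become real as \<open>s\<close> runs
  through \<open>[0, 1]\<close>, so they stay in the lower half plane. Hence the cone is preserved by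
  directional derivatives along its elements, and Euler's formula writes \<open>g (\<Sum>i. y\<^sub>i v\<^sub>i)\<close>, with
  all \<open>v\<^sub>i\<close> in the cone, as a polynomial in \<open>y\<close> with nonnegative coefficients. Such a polynomial
  is log-convex in \<open>ln y\<^sub>i\<close>; its tangent inequality at \<open>y = 1\<close>, applied to the spectral
  projections of a positive definite matrix, is the determinant inequality, because centrality
  makes the gradient at \<open>I\<close> isotropic.

  On a line \<open>B + tA\<close> in the cone the AM-GM inequality for the roots gives
  \<open>tr (D A) \<ge> g(A)\<^bsup>1/N\<^esup>\<close> for the gradient \<open>D\<close> of \<open>g\<^bsup>1/N\<^esup>\<close> at \<open>B\<close>. Together with the determinant
  inequality this forces the eigenvalues of \<open>D\<close> to be positive, and \<open>A = D\<^sup>-\<^sup>1\<close> yields the bound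
  on \<open>det D\<close>.
\<close>

section \<open>Complexification and real-rooted lines\<close>

text \<open>The pair \<open>(u, v)\<close> stands for u + i v in the complexification of the real
  space, and \<open>cscale z\<close> is multiplication by the complex scalar
  \<open>z\<close>.\<close>

definition cscale :: "complex \<Rightarrow> 'a \<times> 'a \<Rightarrow> 'a \<times> 'a::real_vector" where
  "cscale z X = (Re z *\<^sub>R fst X - Im z *\<^sub>R snd X, Im z *\<^sub>R fst X + Re z *\<^sub>R snd X)"

lemma cscale_of_real: "cscale (of_real r) X = r *\<^sub>R X"
  by (simp add: cscale_def prod_eq_iff)

lemma cscale_mult: "cscale (z * w) X = cscale z (cscale w X)"
  by (simp add: cscale_def algebra_simps)

lemma cscale_add_right: "cscale z (X + Y) = cscale z X + cscale z Y"
  by (simp add: cscale_def algebra_simps)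

lemma cscale_one [simp]: "cscale 1 X = X"
  by (simp add: cscale_def)

lemma continuous_on_cscale [continuous_intros]:
  fixes g :: "'b::topological_space \<Rightarrow> 'a \<times> 'a::real_normed_vector"
  assumes "continuous_on S h" "continuous_on S g"
  shows "continuous_on S (\<lambda>x. cscale (h x) (g x))"
  unfolding cscale_def by (intro continuous_intros assms)

lemma poly_map_poly_of_real:
  "poly (map_poly of_real p) (complex_of_real t) = of_real (poly p t)"
  by (induction p) (simp_all add: map_poly_pCons)

text \<open>Holomorphic extension is recorded only through its restrictions to complex lines. These
  are one-variable polynomials, so identities between them can be checked at real parameters and
  continued to complex ones, and one-variable root theory applies.\<close>

definition complex_extension ::
  "('a::real_normed_vector \<Rightarrow> real) \<Rightarrow> ('a \<times> 'a \<Rightarrow> complex) \<Rightarrow> bool" where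
  "complex_extension f F \<longleftrightarrow> (\<forall>u. F (u, 0) = of_real (f u)) \<and> continuous_on UNIV F \<and>
     (\<forall>X Y. \<exists>q. \<forall>z. F (X + cscale z Y) = poly q z)"

text \<open>A linear \<open>f\<close> extends as f(u) + i f(v), and the three defining properties
  pass to sums and products.\<close>

lemma complex_extension_ex:
  fixes f :: "'a::real_normed_vector \<Rightarrow> real"
  assumes "real_polynomial_function f"
  shows "\<exists>F. complex_extension f F"
  using assms
proof induction
  case (linear f)
  then interpret f: bounded_linear f .
  define F where "F X = of_real (f (fst X)) + \<i> * of_real (f (snd X))" for X
  have "F (X + cscale z Y) = poly [:F X, F Y:] z" for X Y z
    by (simp add: F_def cscale_def f.add f.diff f.scaleR complex_eq_iff algebra_simps)
  moreover have "continuous_on UNIV F"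
    unfolding F_def by (intro continuous_intros f.continuous_on)
  moreover have "F (u, 0) = of_real (f u)" for u
    by (simp add: F_def f.zero)
  ultimately have "complex_extension f F"
    unfolding complex_extension_def by blast
  then show ?case by blast
next
  case (const c)
  have "\<exists>q. \<forall>z. of_real c = poly q z"
    by (rule exI[of _ "[:of_real c:]"]) simp
  then have "complex_extension (\<lambda>x::'a. c) (\<lambda>X. of_real c)"
    by (simp add: complex_extension_def)
  then show ?case by blast
next
  case (add f g)
  then obtain F G where FG: "complex_extension f F" "complex_extension g G"
    by blast
  have "\<exists>q. \<forall>z. F (X + cscale z Y) + G (X + cscale z Y) = poly q z" for X Y
    using FG unfolding complex_extension_def by (metis poly_add)
  with FG have "complex_extension (\<lambda>x. f x + g x) (\<lambda>X. F X + G X)"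
    by (auto simp: complex_extension_def intro!: continuous_intros)
  then show ?case by blast
next
  case (mult f g)
  then obtain F G where FG: "complex_extension f F" "complex_extension g G"
    by blast
  have "\<exists>q. \<forall>z. F (X + cscale z Y) * G (X + cscale z Y) = poly q z" for X Y
    using FG unfolding complex_extension_def by (metis poly_mult)
  with FG have "complex_extension (\<lambda>x. f x * g x) (\<lambda>X. F X * G X)"
    by (auto simp: complex_extension_def intro!: continuous_intros)
  then show ?case by blast
qed

lemma complex_poly_eqI_real:
  fixes p q :: "complex poly"
  assumes "\<And>t. poly p (of_real t) = poly q (of_real t)"
  shows "p = q"
proof (rule ccontr)
  assume "p \<noteq> q"
  then have "finite {z. poly (p - q) z = 0}"
    by (intro poly_roots_finite) auto
  moreover have "range complex_of_real \<subseteq> {z. poly (p - q) z = 0}"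
    using assms by auto
  ultimately have "finite (range complex_of_real)"
    by (rule rev_finite_subset)
  then show False
    using finite_imageD[of complex_of_real UNIV] infinite_UNIV_char_0
    by (auto simp: inj_on_def)
qed

definition homogeneous_poly :: "nat \<Rightarrow> ('a::real_normed_vector \<Rightarrow> real) \<Rightarrow> bool" where
  "homogeneous_poly N f \<longleftrightarrow>
     real_polynomial_function f \<and> (\<forall>t x. f (t *\<^sub>R x) = t ^ N * f x)"

lemma homogeneous_poly_scale: "homogeneous_poly N f \<Longrightarrow> f (t *\<^sub>R x) = t ^ N * f x"
  by (simp add: homogeneous_poly_def)

text \<open>Analytic continuation in two stages: real homogeneity on the real lines u + w v is
  continued to w = i, which gives real scalars at a complex point; then w \<mapsto> F(w X) is a
  polynomial that agrees with a monomial at all real w.\<close>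

lemma complex_extension_homogeneous:
  assumes F: "complex_extension f F" and f: "homogeneous_poly N f"
  shows "F (cscale z X) = z ^ N * F X"
proof -
  have real: "F (t *\<^sub>R X) = of_real t ^ N * F X" for t X
  proof -
    obtain u v where X: "X = (u, v)"
      by (cases X)
    obtain p q where p: "\<And>w. F ((t *\<^sub>R u, 0) + cscale w (t *\<^sub>R v, 0)) = poly p w"
      and q: "\<And>w. F ((u, 0) + cscale w (v, 0)) = poly q w"
      using F unfolding complex_extension_def by meson
    have "p = smult (of_real t ^ N) q"
    proof (rule complex_poly_eqI_real)
      fix r
      have "F (t *\<^sub>R u + r *\<^sub>R t *\<^sub>R v, 0) = of_real (f (t *\<^sub>R (u + r *\<^sub>R v)))"
        using F by (simp add: complex_extension_def algebra_simps)
      also have "\<dots> = of_real t ^ N * of_real (f (u + r *\<^sub>R v))"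
        by (simp add: homogeneous_poly_scale[OF f])
      also have "\<dots> = of_real t ^ N * F (u + r *\<^sub>R v, 0)"
        using F by (simp add: complex_extension_def)
      finally show "poly p (of_real r) = poly (smult (of_real t ^ N) q) (of_real r)"
        by (simp flip: p q add: cscale_of_real)
    qed
    then show ?thesis
      using p[of \<i>] q[of \<i>] by (simp add: X cscale_def)
  qed
  obtain q where q: "\<And>w. F (0 + cscale w X) = poly q w"
    using F unfolding complex_extension_def by meson
  have "q = monom (F X) N"
    by (rule complex_poly_eqI_real) (simp flip: q add: cscale_of_real real poly_monom)
  then show ?thesis
    using q[of z] by (simp add: poly_monom)
qed

lemma real_polynomial_function_line:
  assumes "real_polynomial_function f"
  obtains p where "\<And>t. poly p t = f (y + t *\<^sub>R a)"
proof -
  have "polynomial_function (\<lambda>t::real. y + t *\<^sub>R a)"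
    by (intro polynomial_function_add polynomial_function_const
        polynomial_function_bounded_linear bounded_linear_scaleR_left)
  from real_polynomial_function_compose[OF this assms]
  obtain c n where *: "f \<circ> (\<lambda>t::real. y + t *\<^sub>R a) = (\<lambda>t. \<Sum>i\<le>n. c i * t ^ i)"
    using real_polynomial_function_imp_sum by blast
  have "poly (\<Sum>i\<le>n. monom (c i) i) t = f (y + t *\<^sub>R a)" for t
    using fun_cong[OF *, of t] by (simp add: poly_sum poly_monom)
  then show ?thesis
    by (rule that)
qed

lemma complex_extension_line:
  assumes F: "complex_extension f F" and p: "\<And>t. poly p t = f (y + t *\<^sub>R a)"
  shows "F ((y, 0) + cscale z (a, 0)) = poly (map_poly of_real p) z"
proof -
  obtain q where q: "\<And>z. F ((y, 0) + cscale z (a, 0)) = poly q z"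
    using F unfolding complex_extension_def by meson
  have "q = map_poly of_real p"
  proof (rule complex_poly_eqI_real)
    fix t
    have "poly q (of_real t) = F (y + t *\<^sub>R a, 0)"
      by (simp flip: q add: cscale_of_real)
    also have "\<dots> = of_real (poly p t)"
      using F p by (simp add: complex_extension_def)
    finally show "poly q (of_real t) = poly (map_poly of_real p) (of_real t)"
      by (simp add: poly_map_poly_of_real)
  qed
  then show ?thesis
    by (simp add: q)
qed

text \<open>By homogeneity p(t) = t^N q(1/t) with q(s) = f(a + s y), so p is a reversal of q. Since
  q(0) = f(a) is nonzero, the reversal has leading coefficient f(a) and p has degree exactly
  N.\<close>

lemma homogeneous_poly_line_degree:
  assumes f: "homogeneous_poly N f" and a: "f a \<noteq> 0"
    and p: "\<And>t. poly p t = f (y + t *\<^sub>R a)"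
  shows "degree p = N" and "lead_coeff p = f a"
proof -
  obtain q where q: "\<And>s. poly q s = f (a + s *\<^sub>R y)"
    using f real_polynomial_function_line unfolding homogeneous_poly_def by blast
  have q0: "coeff q 0 = f a"
    using q[of 0] by (simp add: poly_0_coeff_0)
  \<comment> \<open>\<open>reflect_poly\<close> reverses with respect to \<open>degree q\<close>,
    which may be below N; the factor t^(degree q) on the left compensates for this.\<close>
  have eq: "poly (p * monom 1 (degree q)) t = poly (monom 1 N * reflect_poly q) t"
    if "t \<noteq> 0" for t
  proof -
    have "f (y + t *\<^sub>R a) = f (t *\<^sub>R (a + inverse t *\<^sub>R y))"
      using that by (simp add: algebra_simps)
    then have "poly p t = t ^ N * poly q (inverse t)"
      using p q by (simp add: homogeneous_poly_scale[OF f])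
    then show ?thesis
      using that by (simp add: poly_reflect_poly_nz poly_monom)
  qed
  have "p * monom 1 (degree q) - monom 1 N * reflect_poly q = 0"
  proof (rule ccontr)
    assume "\<not> ?thesis"
    then have "finite {t. poly (p * monom 1 (degree q) - monom 1 N * reflect_poly q) t = 0}"
      by (rule poly_roots_finite)
    moreover have "- {0} \<subseteq> {t. poly (p * monom 1 (degree q) - monom 1 N * reflect_poly q) t = 0}"
      using eq by auto
    ultimately have "finite (- {0::real})"
      by (rule rev_finite_subset)
    then show False
      using infinite_UNIV_char_0[where 'a=real] by (simp add: Compl_eq_Diff_UNIV)
  qed
  then have eq: "p * monom 1 (degree q) = monom 1 N * reflect_poly q"
    by simp
  have "q \<noteq> 0" using q0 a by auto
  then have "p \<noteq> 0"
    using eq by (auto simp: monom_eq_0_iff)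
  have "degree p + degree q = N + degree q"
    using arg_cong[OF eq, of degree] q0 a \<open>p \<noteq> 0\<close> \<open>q \<noteq> 0\<close>
    by (simp add: degree_mult_eq monom_eq_0_iff degree_monom_eq degree_reflect_poly_eq)
  then show "degree p = N"
    by simp
  show "lead_coeff p = f a"
    using arg_cong[OF eq, of lead_coeff] q0 a
    by (simp add: lead_coeff_mult degree_monom_eq degree_reflect_poly_eq coeff_reflect_poly)
qed

lemma real_rooted_decompose:
  fixes p :: "real poly"
  assumes "\<And>z::complex. poly (map_poly of_real p) z = 0 \<Longrightarrow> z \<in> \<real>"
  obtains \<mu> where "\<And>t. poly p t = lead_coeff p * (\<Prod>j<degree p. t + \<mu> j)"
proof -
  let ?P = "map_poly complex_of_real p"
  have deg: "degree ?P = degree p"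
    by (simp add: degree_map_poly)
  obtain r where "smult (lead_coeff ?P) (\<Prod>j<degree ?P. [:- r j, 1:]) = ?P"
    by (rule complex_poly_decompose')
  then have r: "smult (of_real (lead_coeff p)) (\<Prod>j<degree p. [:- r j, 1:]) = ?P"
    by (simp add: deg coeff_map_poly)
  have "r j \<in> \<real>" if "j < degree p" for j
  proof -
    have "poly ?P (r j) = 0"
      using that by (subst r[symmetric]) (auto simp: poly_prod)
    then show ?thesis
      by (rule assms)
  qed
  then have Re: "complex_of_real (Re (r j)) = r j" if "j < degree p" for j
    using that by (simp add: complex_is_Real_iff complex_eq_iff)
  have "poly p t = lead_coeff p * (\<Prod>j<degree p. t + - Re (r j))" for t
  proof -
    have "complex_of_real (poly p t) = poly ?P (of_real t)"
      by (simp add: poly_map_poly_of_real)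
    also have "\<dots> = of_real (lead_coeff p) * (\<Prod>j<degree p. of_real t + - r j)"
      by (subst r[symmetric]) (simp add: poly_prod)
    also have "\<dots> = of_real (lead_coeff p * (\<Prod>j<degree p. t + - Re (r j)))"
      by (simp add: Re)
    finally show ?thesis
      by (simp only: of_real_eq_iff)
  qed
  then show ?thesis
    by (rule that)
qed

text \<open>The numbers \<open>\<mu> j\<close> are the Garding eigenvalues of \<open>y\<close>
  relative to \<open>a\<close>, that is, the negatives of the roots. Stating real-rootedness as a
  full factorization also fixes the degree N and the leading coefficient f(a).\<close>

definition hyperbolic_along :: "nat \<Rightarrow> ('a::real_vector \<Rightarrow> real) \<Rightarrow> 'a \<Rightarrow> bool" where
  "hyperbolic_along N f a \<longleftrightarrow>
     0 < f a \<and> (\<forall>y. \<exists>\<mu>. \<forall>t. f (y + t *\<^sub>R a) = f a * (\<Prod>j<N. t + \<mu> j))"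

lemma hyperbolic_alongI_poly:
  assumes f: "homogeneous_poly N f" and a: "0 < f a"
    and "\<And>y. \<exists>p. (\<forall>t. poly p t = f (y + t *\<^sub>R a)) \<and>
           (\<forall>z::complex. poly (map_poly of_real p) z = 0 \<longrightarrow> z \<in> \<real>)"
  shows "hyperbolic_along N f a"
  unfolding hyperbolic_along_def
proof (intro conjI allI a)
  fix y
  obtain p where p: "\<And>t. poly p t = f (y + t *\<^sub>R a)"
    and rr: "\<And>z::complex. poly (map_poly of_real p) z = 0 \<Longrightarrow> z \<in> \<real>"
    using assms(3) by blast
  have "degree p = N" "lead_coeff p = f a"
    using homogeneous_poly_line_degree[OF f _ p] a by auto
  moreover obtain \<mu> where "\<And>t. poly p t = lead_coeff p * (\<Prod>j<degree p. t + \<mu> j)"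
    using real_rooted_decompose[OF rr] by blast
  ultimately show "\<exists>\<mu>. \<forall>t. f (y + t *\<^sub>R a) = f a * (\<Prod>j<N. t + \<mu> j)"
    using p by metis
qed

text \<open>A nonreal root z of f(y + z a), divided by Im z, would be a zero of \<open>F\<close> at
  a point with imaginary part exactly \<open>a\<close>.\<close>

lemma hyperbolic_alongI:
  assumes f: "homogeneous_poly N f" and F: "complex_extension f F" and a: "0 < f a"
    and nz: "\<And>y. F (y, a) \<noteq> 0"
  shows "hyperbolic_along N f a"
proof (rule hyperbolic_alongI_poly[of N f, OF f a])
  fix y
  obtain p where p: "\<And>t. poly p t = f (y + t *\<^sub>R a)"
    using f real_polynomial_function_line unfolding homogeneous_poly_def by blast
  have "z \<in> \<real>" if "poly (map_poly of_real p) z = 0" for z :: complex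
  proof (rule ccontr)
    assume "z \<notin> \<real>"
    then have z: "Im z \<noteq> 0"
      by (simp add: complex_is_Real_iff)
    let ?u = "inverse (Im z) *\<^sub>R (y + Re z *\<^sub>R a)"
    have "(y, 0) + cscale z (a, 0) = cscale (of_real (Im z)) (?u, a)"
      using z by (simp add: cscale_of_real) (simp add: cscale_def)
    then have "F ((y, 0) + cscale z (a, 0)) = of_real (Im z) ^ N * F (?u, a)"
      by (simp only: complex_extension_homogeneous[OF F f])
    then show False
      using that z nz by (simp add: complex_extension_line[OF F p])
  qed
  then show "\<exists>p. (\<forall>t. poly p t = f (y + t *\<^sub>R a)) \<and>
           (\<forall>z::complex. poly (map_poly of_real p) z = 0 \<longrightarrow> z \<in> \<real>)"
    using p by blast
qed

lemma complex_extension_roots: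
  assumes F: "complex_extension f F"
    and \<mu>: "\<And>t. f (y + t *\<^sub>R a) = c * (\<Prod>j<N. t + \<mu> j)"
  shows "F ((y, 0) + cscale z (a, 0)) = of_real c * (\<Prod>j<N. z + of_real (\<mu> j))"
proof -
  let ?p = "smult c (\<Prod>j<N. [:\<mu> j, 1:])"
  have "F ((y, 0) + cscale z (a, 0)) = poly (map_poly of_real ?p) z"
    by (rule complex_extension_line[OF F]) (simp add: \<mu> poly_prod add.commute)
  also have "map_poly of_real ?p = smult (of_real c) (\<Prod>j<N. [:complex_of_real (\<mu> j), 1:])"
    by (rule complex_poly_eqI_real)
       (simp add: poly_map_poly_of_real poly_prod add.commute)
  finally show ?thesis
    by (simp add: poly_prod add.commute)
qed

section \<open>Changing the direction of hyperbolicity\<close>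

lemma hyperbolic_along_pos: "hyperbolic_along N f a \<Longrightarrow> 0 < f a"
  by (simp add: hyperbolic_along_def)

text \<open>
  \<open>W\<close> collects the \<open>s\<close> for which some root \<open>t\<close> lies in the closed upper half plane. It is closed
  because the roots are bounded, and its complement is closed by Hurwitz's theorem.
\<close>

lemma garding_homotopy:
  fixes f :: "'a::euclidean_space \<Rightarrow> real"
  assumes f: "homogeneous_poly N f" and F: "complex_extension f F"
    and e: "hyperbolic_along N f e" and \<alpha>: "0 < \<alpha>"
    and \<mu>: "\<And>t. f (a + t *\<^sub>R e) = f e * (\<Prod>j<N. t + \<mu> j)" "\<And>j. j < N \<Longrightarrow> 0 < \<mu> j"
  shows "F (y, a + \<alpha> *\<^sub>R e) \<noteq> 0"
proof -
  \<comment> \<open>\<open>G s t\<close> is \<open>F\<close> at s y + t a + i \<alpha> e. The target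
    value is \<open>G 1 \<i>\<close>, because i a joins i \<alpha> e in the imaginary part.\<close>
  define G where "G s t = F ((s *\<^sub>R y, \<alpha> *\<^sub>R e) + cscale t (a, 0))" for s t
  define W where "W = {s \<in> {0..1}. \<exists>t. 0 \<le> Im t \<and> G s t = 0}"
  have fe: "0 < f e"
    using e by (rule hyperbolic_along_pos)
  have fa: "0 < f a"
    using \<mu>(1)[of 0] \<mu>(2) fe by (auto intro!: mult_pos_pos prod_pos)
  have contF: "continuous_on UNIV F"
    using F by (simp add: complex_extension_def)
  have contG: "continuous_on UNIV (\<lambda>x. G (fst x) (snd x))"
    unfolding G_def
    by (intro continuous_on_compose2[OF contF] continuous_intros) auto
  \<comment> \<open>For real t the point is a real vector plus i \<alpha> e, and hyperbolicity along
    \<open>e\<close> forbids the root i \<alpha>. So no root can cross the real axis.\<close>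
  have real: "G s t \<noteq> 0" if "Im t = 0" for s t
  proof -
    let ?y = "s *\<^sub>R y + Re t *\<^sub>R a"
    obtain \<nu> where \<nu>: "\<And>t. f (?y + t *\<^sub>R e) = f e * (\<Prod>j<N. t + \<nu> j)"
      using e unfolding hyperbolic_along_def by blast
    have "(s *\<^sub>R y, \<alpha> *\<^sub>R e) + cscale t (a, 0) = (?y, 0) + cscale (\<i> * of_real \<alpha>) (e, 0)"
      using that by (simp add: cscale_def)
    then have "G s t = of_real (f e) * (\<Prod>j<N. \<i> * of_real \<alpha> + of_real (\<nu> j))"
      unfolding G_def by (simp only: complex_extension_roots[OF F \<nu>])
    moreover have "\<i> * of_real \<alpha> + of_real (\<nu> j) \<noteq> 0" for j
      using \<alpha> by (simp add: complex_eq_iff)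
    ultimately show ?thesis
      using fe by simp
  qed
  \<comment> \<open>At s = 0 homogeneity turns a root t into the root i \<alpha> / t of w \<mapsto>
    f(a + w e), which must be some -\<mu>_j. Then t = -i \<alpha> / \<mu>_j lies in the lower half
    plane.\<close>
  have zero: "G 0 t \<noteq> 0" if "0 \<le> Im t" for t
  proof
    assume G0: "G 0 t = 0"
    with real have "Im t \<noteq> 0" by blast
    with that have t: "t \<noteq> 0" "0 < Im t"
      by auto
    let ?w = "\<i> * of_real \<alpha> / t"
    have "cscale t ((a, 0) + cscale ?w (e, 0)) = cscale t (a, 0) + cscale (\<i> * of_real \<alpha>) (e, 0)"
      using t by (simp add: cscale_add_right flip: cscale_mult)
    then have "(0 *\<^sub>R y, \<alpha> *\<^sub>R e) + cscale t (a, 0) = cscale t ((a, 0) + cscale ?w (e, 0))"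
      by (simp add: cscale_def)
    then have "G 0 t = t ^ N * (of_real (f e) * (\<Prod>j<N. ?w + of_real (\<mu> j)))"
      unfolding G_def
      by (simp only: complex_extension_homogeneous[OF F f] complex_extension_roots[OF F \<mu>(1)])
    then obtain j where j: "j < N" "?w + of_real (\<mu> j) = 0"
      using G0 t fe by auto
    have "\<i> * of_real \<alpha> = - of_real (\<mu> j) * t"
      using j(2) t by (simp add: field_simps add_eq_0_iff)
    then have "\<alpha> = - \<mu> j * Im t"
      by (simp add: complex_eq_iff)
    then show False
      using \<alpha> \<mu>(2)[OF j(1)] t by (smt (verit) mult_pos_pos mult_minus_left)
  qed
  \<comment> \<open>After division by t^N the argument of \<open>F\<close> is \<open>a\<close> plus
    a perturbation of order 1 / |t|, and \<open>F\<close> does not vanish near \<open>a\<close>. The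
    factor 2 in the bound comes from estimating real and imaginary parts separately by
    \<open>C\<close>.\<close>
  obtain M where M: "\<And>s t. s \<in> {0..1} \<Longrightarrow> G s t = 0 \<Longrightarrow> norm t \<le> M"
  proof -
    have "F (a, 0) \<noteq> 0"
      using F fa by (simp add: complex_extension_def)
    moreover have "continuous (at (a, 0)) F"
      using contF by (simp add: continuous_on_eq_continuous_at)
    ultimately obtain d where d: "0 < d" "\<And>X. dist (a, 0) X < d \<Longrightarrow> F X \<noteq> 0"
      using continuous_at_avoid by metis
    define C where "C = norm y + \<alpha> * norm e"
    have "norm t \<le> 2 * C / d" if s: "s \<in> {0..1}" and G: "G s t = 0" for s t
    proof (rule ccontr)
      assume t: "\<not> norm t \<le> 2 * C / d"
      have C: "0 \<le> C"
        using \<alpha> by (simp add: C_def)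
      have nt: "0 < norm t"
        using t C d by (smt (verit) divide_nonneg_pos)
      have small: "norm (cscale (inverse t) (s *\<^sub>R y, \<alpha> *\<^sub>R e)) < d"
      proof -
        have sy: "s * norm y \<le> norm y"
          using s by (auto intro: mult_left_le_one_le)
        have le: "norm (r *\<^sub>R s *\<^sub>R y) \<le> norm (inverse t) * norm y"
          "norm (r *\<^sub>R \<alpha> *\<^sub>R e) \<le> norm (inverse t) * (\<alpha> * norm e)"
          if "\<bar>r\<bar> \<le> norm (inverse t)" for r
        proof -
          have "norm (r *\<^sub>R s *\<^sub>R y) = \<bar>r\<bar> * (s * norm y)"
            "norm (r *\<^sub>R \<alpha> *\<^sub>R e) = \<bar>r\<bar> * (\<alpha> * norm e)"
            using s \<alpha> by (simp_all add: abs_mult)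
          then show "norm (r *\<^sub>R s *\<^sub>R y) \<le> norm (inverse t) * norm y"
            "norm (r *\<^sub>R \<alpha> *\<^sub>R e) \<le> norm (inverse t) * (\<alpha> * norm e)"
            using that s sy \<alpha> by (auto simp del: norm_scaleR intro!: mult_mono)
        qed
        note le = le[OF abs_Re_le_cmod] le[OF abs_Im_le_cmod]
        have "norm (cscale (inverse t) (s *\<^sub>R y, \<alpha> *\<^sub>R e))
            \<le> norm (Re (inverse t) *\<^sub>R s *\<^sub>R y - Im (inverse t) *\<^sub>R \<alpha> *\<^sub>R e) +
              norm (Im (inverse t) *\<^sub>R s *\<^sub>R y + Re (inverse t) *\<^sub>R \<alpha> *\<^sub>R e)"
          unfolding cscale_def by (simp only: fst_conv snd_conv norm_Pair_le)
        also have "\<dots> \<le> norm (inverse t) * C + norm (inverse t) * C"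
          unfolding C_def distrib_left
          by (intro add_mono order_trans[OF norm_triangle_ineq] order_trans[OF norm_triangle_ineq4] le)
        also have "\<dots> = 2 * C / norm t"
          by (simp add: norm_inverse divide_inverse)
        also have "\<dots> < d"
          using t nt d by (simp add: field_simps)
        finally show ?thesis .
      qed
      have "(s *\<^sub>R y, \<alpha> *\<^sub>R e) + cscale t (a, 0) =
          cscale t ((a, 0) + cscale (inverse t) (s *\<^sub>R y, \<alpha> *\<^sub>R e))"
        using nt by (simp add: cscale_add_right add.commute flip: cscale_mult)
      then have "G s t = t ^ N * F ((a, 0) + cscale (inverse t) (s *\<^sub>R y, \<alpha> *\<^sub>R e))"
        unfolding G_def by (simp only: complex_extension_homogeneous[OF F f])
      moreover have "dist (a, 0) ((a, 0) + cscale (inverse t) (s *\<^sub>R y, \<alpha> *\<^sub>R e)) < d"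
        using small by (simp add: dist_norm)
      ultimately show False
        using G d(2) nt by auto
    qed
    then show ?thesis
      by (rule that)
  qed
  \<comment> \<open>The bound \<open>M\<close> makes \<open>W\<close> the projection of a compact
    set.\<close>
  have "closed W"
  proof -
    have "closed {x. G (fst x) (snd x) = 0}"
      using contG by (intro closed_Collect_eq) auto
    moreover have "closed {t. 0 \<le> Im t}"
      by (simp add: closed_halfspace_Im_ge)
    ultimately have "compact ({0..1} \<times> (cball 0 M \<inter> {t. 0 \<le> Im t}) \<inter> {x. G (fst x) (snd x) = 0})"
      by (intro compact_Int_closed compact_Times) auto
    then have "compact (fst ` ({0..1} \<times> (cball 0 M \<inter> {t. 0 \<le> Im t}) \<inter> {x. G (fst x) (snd x) = 0}))"
      by (intro compact_continuous_image continuous_intros)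
    moreover have "W = fst ` ({0..1} \<times> (cball 0 M \<inter> {t. 0 \<le> Im t}) \<inter> {x. G (fst x) (snd x) = 0})"
      using M by (force simp: W_def image_iff)
    ultimately show ?thesis
      by (simp add: compact_imp_closed)
  qed
  have "closed ({0..1} - W)"
  proof (unfold closed_sequential_limits, intro allI impI, elim conjE)
    fix x s
    assume x: "\<forall>n. x n \<in> {0..1} - W" and lim: "x \<longlonglongrightarrow> s"
    have s01: "s \<in> {0..1}"
      using x lim closed_sequentially[of "{0..1::real}" x s] by auto
    moreover have "s \<notin> W"
    proof
      assume "s \<in> W"
      then obtain t0 where t0: "0 \<le> Im t0" "G s t0 = 0"
        by (auto simp: W_def)
      with real have "Im t0 \<noteq> 0" by blast
      with t0 have im: "0 < Im t0" by simp
      have poly: "\<exists>q. \<forall>t. G s t = poly q t" for s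
        unfolding G_def using F by (simp add: complex_extension_def)
      then have hol: "G s holomorphic_on A" for s A
      proof -
        obtain q where "\<And>t. G s t = poly q t"
          using poly by blast
        then have "G s = (\<lambda>t. poly q t)"
          by (rule ext)
        then show ?thesis
          by (auto intro!: holomorphic_intros)
      qed
      have "G s t0 \<noteq> 0"
      proof (rule Hurwitz_no_zeros[where S = "{t. 0 < Im t}" and \<F> = "\<lambda>n. G (x n)"
            and g = "G s" and ?z0.0 = t0])
        show "open {t. 0 < Im t}"
          by (simp add: open_halfspace_Im_gt)
        show "connected {t. 0 < Im t}"
          by (simp add: convex_connected convex_halfspace_Im_gt)
        \<comment> \<open>A constant \<open>G s\<close> would vanish on the whole half plane because
          of \<open>t0\<close>, hence be the zero polynomial, contradicting its nonvanishing at the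
          real point 0.\<close>
        show "\<not> G s constant_on {t. 0 < Im t}"
        proof
          assume "G s constant_on {t. 0 < Im t}"
          then have z: "G s t = 0" if "0 < Im t" for t
            using t0 im that unfolding constant_on_def by fastforce
          obtain q where q: "\<And>t. G s t = poly q t"
            using poly by blast
          have "q = 0"
          proof (rule ccontr)
            assume "q \<noteq> 0"
            then have "finite {t. poly q t = 0}"
              by (rule poly_roots_finite)
            moreover have "(\<lambda>r. Complex r 1) ` UNIV \<subseteq> {t. poly q t = 0}"
              using z q by auto
            ultimately have "finite (range (\<lambda>r. Complex r 1))"
              by (rule rev_finite_subset)
            then show False
              using finite_imageD[of "\<lambda>r. Complex r 1" UNIV] infinite_UNIV_char_0
              by (auto simp: inj_on_def)
          qed
          then show False
            using q real[of 0 s] by simp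
        qed
        show "\<And>n t. t \<in> {t. 0 < Im t} \<Longrightarrow> G (x n) t \<noteq> 0"
          using x by (force simp: W_def)
        show "uniform_limit K (\<lambda>n. G (x n)) (G s) sequentially"
          if K: "compact K" "K \<subseteq> {t. 0 < Im t}" for K
        proof -
          have "uniformly_continuous_on ({0..1} \<times> K) (\<lambda>x. G (fst x) (snd x))"
            using contG K
            by (intro compact_uniformly_continuous compact_Times) (auto intro: continuous_on_subset)
          then have "\<forall>e>0. \<exists>d>0. \<forall>X\<in>{0..1}\<times>K. \<forall>Y\<in>{0..1}\<times>K. dist Y X < d \<longrightarrow>
              dist (G (fst Y) (snd Y)) (G (fst X) (snd X)) < e"
            by (simp add: uniformly_continuous_on_def)
          then show ?thesis
            unfolding uniform_limit_iff
          proof (intro allI impI)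
            fix e :: real assume "0 < e"
            then obtain d where d: "d > 0" "\<And>X Y. X\<in>{0..1}\<times>K \<Longrightarrow> Y\<in>{0..1}\<times>K \<Longrightarrow> dist Y X < d \<Longrightarrow>
              dist (G (fst Y) (snd Y)) (G (fst X) (snd X)) < e"
              using \<open>\<forall>e>0. _ e\<close> by meson
            have "\<forall>\<^sub>F n in sequentially. dist (x n) s < d"
              using lim d(1) by (simp add: tendsto_iff)
            then show "\<forall>\<^sub>F n in sequentially. \<forall>t\<in>K. dist (G (x n) t) (G s t) < e"
            proof eventually_elim
              case (elim n)
              then show ?case
                using d(2)[of "(s, _)" "(x n, _)"] s01 x by (auto simp: dist_Pair_Pair)
            qed
          qed
        qed
      qed (use hol im in auto)
      with t0 show False by simp
    qed
    ultimately show "s \<in> {0..1} - W"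
      by simp
  qed
  with \<open>closed W\<close> have "W \<inter> {0..1} = {} \<or> ({0..1} - W) \<inter> {0..1} = {}"
    by (intro connected_closedD[OF connected_Icc]) (auto simp: W_def)
  moreover have "0 \<in> ({0..1} - W) \<inter> {0..1}"
    using zero by (auto simp: W_def)
  ultimately have "1 \<notin> W"
    by (auto simp del: Int_iff Diff_iff)
  then have "G 1 \<i> \<noteq> 0"
    by (simp add: W_def)
  then show ?thesis
    by (simp add: G_def cscale_def add.commute)
qed

text \<open>The homotopy result needs a spare multiple of \<open>e\<close>. For \<alpha> below all
  eigenvalues, a - \<alpha> e still has positive eigenvalues, and adding \<alpha> e back gives F
  \<noteq> 0 at imaginary part \<open>a\<close>.\<close>

lemma hyperbolic_along_transfer:
  fixes f :: "'a::euclidean_space \<Rightarrow> real"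
  assumes f: "homogeneous_poly N f" and e: "hyperbolic_along N f e"
    and \<mu>: "\<And>t. f (a + t *\<^sub>R e) = f e * (\<Prod>j<N. t + \<mu> j)" "\<And>j. j < N \<Longrightarrow> 0 < \<mu> j"
  shows "hyperbolic_along N f a"
proof -
  obtain F where F: "complex_extension f F"
    using f complex_extension_ex unfolding homogeneous_poly_def by blast
  obtain \<alpha> where \<alpha>: "0 < \<alpha>" "\<And>j. j < N \<Longrightarrow> \<alpha> < \<mu> j"
  proof -
    \<comment> \<open>Inserting 1 keeps the set nonempty when N = 0.\<close>
    let ?m = "Min (insert 1 (\<mu> ` {..<N}))"
    have "0 < ?m"
      using \<mu>(2) by auto
    moreover have "?m \<le> \<mu> j" if "j < N" for j
      using that by (intro Min_le) auto
    ultimately show ?thesis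
      by (intro that[of "?m / 2"]) (linarith, smt (verit) field_sum_of_halves)
  qed
  have "f (a - \<alpha> *\<^sub>R e + t *\<^sub>R e) = f e * (\<Prod>j<N. t + (\<mu> j - \<alpha>))" for t
    using \<mu>(1)[of "t - \<alpha>"] by (simp add: algebra_simps)
  from garding_homotopy[OF f F e \<alpha>(1) this] \<alpha>(2)
  have "F (y, a) \<noteq> 0" for y
    by simp
  moreover have "0 < f a"
    using \<mu>(1)[of 0] \<mu>(2) e by (auto simp: hyperbolic_along_def intro!: mult_pos_pos prod_pos)
  ultimately show ?thesis
    using hyperbolic_alongI[OF f F] by blast
qed

section \<open>Positivity of eigenvalues, derivatives and inequalities on the cone\<close>

lemma continuous_on_real_polynomial_function:
  "real_polynomial_function f \<Longrightarrow> continuous_on S f"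
  by (simp add: continuous_on_polymonial_function flip: real_polynomial_function_eq)

lemma continuous_on_homogeneous_poly:
  fixes f :: "'a::euclidean_space \<Rightarrow> real"
  assumes "homogeneous_poly N f" "continuous_on T h"
  shows "continuous_on T (\<lambda>x. f (h x))"
  using assms continuous_on_compose2[of UNIV f T h]
  by (auto simp: homogeneous_poly_def continuous_on_real_polynomial_function)

text \<open>A clopen argument in \<open>S\<close>. \<open>T\<close> asks that f(b + t e) never drop
  below f(b) for t \<ge> 0, a closed condition. \<open>U\<close> asks that f be positive on the
  compact segment from b to e, an open condition. The two sets coincide and contain
  \<open>e\<close>.\<close>

lemma garding_eigenvalues_pos:
  fixes f :: "'a::euclidean_space \<Rightarrow> real"
  assumes f: "homogeneous_poly N f" and S: "connected S" "\<And>x. x \<in> S \<Longrightarrow> 0 < f x"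
    and e: "e \<in> S" "hyperbolic_along N f e" and b: "b \<in> S"
    and \<mu>: "\<And>t. f (b + t *\<^sub>R e) = f e * (\<Prod>j<N. t + \<mu> j)" and j: "j < N"
  shows "0 < \<mu> j"
proof -
  define T where "T = S \<inter> (\<Inter>t\<in>{0..}. {b. f b \<le> f (b + t *\<^sub>R e)})"
  define U where "U = S \<inter> - {b. \<exists>u. u \<in> {0..1} \<and> (u, b) \<in> {x. f ((1 - fst x) *\<^sub>R snd x + fst x *\<^sub>R e) \<le> 0}}"
  note cont = continuous_on_homogeneous_poly[OF f]
  have fe: "0 < f e"
    using S e by blast
  \<comment> \<open>A nonpositive \<nu>_j would put the zero t = -\<nu>_j on the ray t \<ge>
    0.\<close>
  have pos: "0 < \<nu> j" if "\<And>t. 0 \<le> t \<Longrightarrow> 0 < f (c + t *\<^sub>R e)" "j < N"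
    "\<And>t. f (c + t *\<^sub>R e) = f e * (\<Prod>j<N. t + \<nu> j)" for c \<nu> j
  proof (rule ccontr)
    assume "\<not> 0 < \<nu> j"
    then have "0 < f (c + (- \<nu> j) *\<^sub>R e)"
      by (intro that) simp
    moreover have zero: "(\<Prod>i<N. - \<nu> j + \<nu> i) = 0"
      using that(2) by (intro prod_zero) auto
    have "f (c + (- \<nu> j) *\<^sub>R e) = 0"
      by (simp only: that(3) zero mult_zero_right)
    ultimately show False
      by simp
  qed
  have "T = U"
  proof (intro set_eqI iffI)
    fix c assume c: "c \<in> T"
    then have ge: "f c \<le> f (c + t *\<^sub>R e)" if "0 \<le> t" for t
      using that by (auto simp: T_def)
    have cS: "c \<in> S" using c by (simp add: T_def)
    have "0 < f ((1 - u) *\<^sub>R c + u *\<^sub>R e)" if u: "0 \<le> u" "u \<le> 1" for u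
    proof (cases "u = 1")
      case False
      with u have u1: "0 < 1 - u" by simp
      \<comment> \<open>Up to positive factors, the segment from c towards e and the ray c + t e
        consist of the same points, so positivity passes between them by homogeneity.\<close>
      have "(1 - u) *\<^sub>R c + u *\<^sub>R e = (1 - u) *\<^sub>R (c + (u / (1 - u)) *\<^sub>R e)"
        using u1 by (simp add: scaleR_add_right)
      moreover have "0 < f (c + (u / (1 - u)) *\<^sub>R e)"
        using ge[of "u / (1 - u)"] S(2)[OF cS] u u1 by (simp add: less_le_trans)
      ultimately show ?thesis
        using u1 by (simp add: homogeneous_poly_scale[OF f])
    qed (simp add: fe)
    then show "c \<in> U"
      using cS by (force simp: U_def not_le)
  next
    fix c assume c: "c \<in> U"
    then have cS: "c \<in> S" by (simp add: U_def)
    from c have seg: "0 < f ((1 - u) *\<^sub>R c + u *\<^sub>R e)" if "0 \<le> u" "u \<le> 1" for u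
      using that by (auto simp: U_def not_le dest!: spec[of _ u])
    have line: "0 < f (c + t *\<^sub>R e)" if t: "0 \<le> t" for t
    proof -
      have "c + t *\<^sub>R e = (1 + t) *\<^sub>R ((1 - t / (1 + t)) *\<^sub>R c + (t / (1 + t)) *\<^sub>R e)"
        using t by (simp add: scaleR_add_right diff_divide_distrib[symmetric] field_simps)
      moreover have "0 < f ((1 - t / (1 + t)) *\<^sub>R c + (t / (1 + t)) *\<^sub>R e)"
        using t by (intro seg) (auto simp: field_simps)
      ultimately show ?thesis
        using t by (simp add: homogeneous_poly_scale[OF f])
    qed
    obtain \<nu> where \<nu>: "\<And>t. f (c + t *\<^sub>R e) = f e * (\<Prod>j<N. t + \<nu> j)"
      using e unfolding hyperbolic_along_def by blast
    \<comment> \<open>Positivity on the ray makes all eigenvalues positive, so every factor t +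
      \<nu>_j grows with t.\<close>
    have "f c \<le> f (c + t *\<^sub>R e)" if t: "0 \<le> t" for t
    proof -
      have "f c = f e * (\<Prod>j<N. \<nu> j)"
        using \<nu>[of 0] by simp
      also have "\<dots> \<le> f e * (\<Prod>j<N. t + \<nu> j)"
        using pos[OF line _ \<nu>] t fe by (intro mult_left_mono prod_mono) (auto simp: less_imp_le)
      finally show ?thesis
        by (simp add: \<nu>)
    qed
    then show "c \<in> T"
      using cS by (simp add: T_def)
  qed
  have "closed (\<Inter>t\<in>{0..}. {b. f b \<le> f (b + t *\<^sub>R e)})"
    by (intro closed_INT ballI closed_Collect_le cont continuous_intros)
  then have "closedin (top_of_set S) T"
    unfolding T_def by (rule closedin_closed_Int)
  moreover have "closed {b. \<exists>u. u \<in> {0..1} \<and> (u, b) \<in> {x. f ((1 - fst x) *\<^sub>R snd x + fst x *\<^sub>R e) \<le> 0}}"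
    by (intro closed_compact_projection closed_Collect_le cont continuous_intros compact_Icc)
  then have "openin (top_of_set S) T"
    unfolding \<open>T = U\<close> U_def by (intro openin_open_Int) (simp add: open_Compl)
  moreover have "e \<in> T"
  proof -
    have "f e \<le> f (e + t *\<^sub>R e)" if "0 \<le> t" for t
    proof -
      have "e + t *\<^sub>R e = (1 + t) *\<^sub>R e"
        by (simp add: scaleR_add_left)
      then show ?thesis
        using that fe by (simp add: homogeneous_poly_scale[OF f])
    qed
    then show ?thesis
      using e by (simp add: T_def)
  qed
  ultimately have "b \<in> T"
    using S(1) b unfolding connected_clopen by blast
  then have "f b \<le> f (b + t *\<^sub>R e)" if "0 \<le> t" for t
    using that by (auto simp: T_def)
  then have "0 < f (b + t *\<^sub>R e)" if "0 \<le> t" for t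
    using that S(2)[OF b] by (meson less_le_trans)
  then show ?thesis
    using pos j \<mu> by blast
qed

text \<open>\<open>S\<close> is any connected set of hyperbolic directions rather than a full
  component, so that one \<open>S\<close> serves \<open>f\<close> and all its directional
  derivatives.\<close>

definition garding_on :: "nat \<Rightarrow> ('a::euclidean_space \<Rightarrow> real) \<Rightarrow> 'a set \<Rightarrow> bool" where
  "garding_on N f S \<longleftrightarrow>
     homogeneous_poly N f \<and> connected S \<and> (\<forall>a\<in>S. hyperbolic_along N f a)"

text \<open>One hyperbolic direction suffices: relative to \<open>e\<close> every point of
  \<open>S\<close> has positive eigenvalues, and then hyperbolicity transfers to that point.\<close>

lemma garding_onI:
  assumes f: "homogeneous_poly N f" and S: "connected S" "\<And>x. x \<in> S \<Longrightarrow> 0 < f x"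
    and e: "e \<in> S" "hyperbolic_along N f e"
  shows "garding_on N f S"
  unfolding garding_on_def
proof (intro conjI ballI f S(1))
  fix a assume "a \<in> S"
  obtain \<mu> where \<mu>: "\<And>t. f (a + t *\<^sub>R e) = f e * (\<Prod>j<N. t + \<mu> j)"
    using e(2) unfolding hyperbolic_along_def by blast
  show "hyperbolic_along N f a"
    using garding_eigenvalues_pos[OF f S e \<open>a \<in> S\<close> \<mu>]
    by (rule hyperbolic_along_transfer[OF f e(2) \<mu>])
qed

lemma garding_on_pos: "garding_on N f S \<Longrightarrow> a \<in> S \<Longrightarrow> 0 < f a"
  by (auto simp: garding_on_def hyperbolic_along_def)

lemma garding_on_decompose:
  assumes "garding_on N f S" "a \<in> S" "b \<in> S"
  obtains \<mu> where "\<And>t. f (b + t *\<^sub>R a) = f a * (\<Prod>j<N. t + \<mu> j)" "\<And>j. j < N \<Longrightarrow> 0 < \<mu> j"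
proof -
  obtain \<mu> where \<mu>: "\<And>t. f (b + t *\<^sub>R a) = f a * (\<Prod>j<N. t + \<mu> j)"
    using assms unfolding garding_on_def hyperbolic_along_def by blast
  show ?thesis
  proof (rule that[OF \<mu>])
    show "0 < \<mu> j" if "j < N" for j
      using garding_eigenvalues_pos[of N f S a b \<mu> j] assms that \<mu>
      unfolding garding_on_def by (meson assms(1) garding_on_pos)
  qed
qed

section \<open>Directional derivatives of homogeneous polynomials, and the inequalities they
  yield\<close>

definition dderiv :: "('a::real_normed_vector \<Rightarrow> real) \<Rightarrow> 'a \<Rightarrow> 'a \<Rightarrow> real" where
  "dderiv f v x = frechet_derivative f (at x) v"

lemma dderiv_has_derivative:
  assumes "real_polynomial_function f"
  shows "(f has_derivative (\<lambda>v. dderiv f v x)) (at x)"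
  unfolding dderiv_def
  using differentiable_at_real_polynomial_function[OF assms]
  by (simp add: frechet_derivative_works)

lemma dderiv_line:
  assumes "real_polynomial_function f"
  shows "((\<lambda>t. f (x + t *\<^sub>R v)) has_real_derivative dderiv f v (x + t *\<^sub>R v)) (at t)"
proof -
  have "((\<lambda>t. x + t *\<^sub>R v) has_derivative (\<lambda>s. s *\<^sub>R v)) (at t)"
    by (auto intro!: derivative_eq_intros)
  from has_derivative_compose[OF this dderiv_has_derivative[OF assms]]
  have "((\<lambda>t. f (x + t *\<^sub>R v)) has_derivative (\<lambda>s. dderiv f (s *\<^sub>R v) (x + t *\<^sub>R v))) (at t)" .
  moreover have "dderiv f (s *\<^sub>R v) y = s * dderiv f v y" for s y
    using linear_scale[OF has_derivative_linear[OF dderiv_has_derivative[OF assms]]] by simp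
  ultimately show ?thesis
    by (simp add: has_field_derivative_def mult_commute_abs)
qed

lemma real_polynomial_function_dderiv:
  assumes "real_polynomial_function f"
  shows "real_polynomial_function (dderiv f v)"
  using assms
proof induction
  case (linear f)
  then have "(f has_derivative f) (at x)" for x
    by (rule bounded_linear_imp_has_derivative)
  then have "dderiv f v = (\<lambda>x. f v)"
    using frechet_derivative_at by (metis dderiv_def ext)
  then show ?case by auto
next
  case (const c)
  have "dderiv (\<lambda>x. c) v = (\<lambda>x. 0)"
    by (simp add: dderiv_def fun_eq_iff)
  then show ?case by auto
next
  case (add f g)
  have "dderiv (\<lambda>x. f x + g x) v = (\<lambda>x. dderiv f v x + dderiv g v x)"
  proof
    fix x
    have "((\<lambda>x. f x + g x) has_derivative (\<lambda>v. dderiv f v x + dderiv g v x)) (at x)"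
      using add.hyps by (intro has_derivative_add dderiv_has_derivative)
    then show "dderiv (\<lambda>x. f x + g x) v x = dderiv f v x + dderiv g v x"
      by (simp add: dderiv_def[of "\<lambda>x. f x + g x"] frechet_derivative_at[symmetric])
  qed
  with add.IH show ?case by auto
next
  case (mult f g)
  have "dderiv (\<lambda>x. f x * g x) v = (\<lambda>x. f x * dderiv g v x + dderiv f v x * g x)"
  proof
    fix x
    have "((\<lambda>x. f x * g x) has_derivative (\<lambda>v. f x * dderiv g v x + dderiv f v x * g x)) (at x)"
      using mult.hyps by (intro has_derivative_mult dderiv_has_derivative)
    then show "dderiv (\<lambda>x. f x * g x) v x = f x * dderiv g v x + dderiv f v x * g x"
      by (simp add: dderiv_def[of "\<lambda>x. f x * g x"] frechet_derivative_at[symmetric])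
  qed
  with mult show ?case by auto
qed

text \<open>Differentiate f(t x + t s v) = t^(N+1) f(x + s v) in s at 0 and cancel one factor t; the
  value t = 0 follows by continuity.\<close>

lemma homogeneous_poly_dderiv:
  fixes f :: "'a::euclidean_space \<Rightarrow> real"
  assumes f: "homogeneous_poly (Suc N) f"
  shows "homogeneous_poly N (dderiv f v)"
proof -
  have poly: "real_polynomial_function f"
    using f by (simp add: homogeneous_poly_def)
  note polyd = real_polynomial_function_dderiv[OF poly]
  have nz: "dderiv f v (t *\<^sub>R x) = t ^ N * dderiv f v x" if "t \<noteq> 0" for t x
  proof -
    have eq: "f (t *\<^sub>R x + (t * s) *\<^sub>R v) = t ^ Suc N * f (x + s *\<^sub>R v)" for s
      using homogeneous_poly_scale[OF f, of t "x + s *\<^sub>R v"] by (simp add: scaleR_add_right)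
    have "((\<lambda>s. f (t *\<^sub>R x + (t * s) *\<^sub>R v)) has_real_derivative t ^ Suc N * dderiv f v (x + 0 *\<^sub>R v)) (at 0)"
      unfolding eq by (intro DERIV_cmult dderiv_line poly)
    moreover have "((\<lambda>s. f (t *\<^sub>R x + (t * s) *\<^sub>R v)) has_real_derivative
        dderiv f v (t *\<^sub>R x + (t * 0) *\<^sub>R v) * t) (at 0)"
      by (rule DERIV_chain2[OF dderiv_line[OF poly]]) (auto intro!: derivative_eq_intros)
    ultimately have "t ^ Suc N * dderiv f v (x + 0 *\<^sub>R v) = dderiv f v (t *\<^sub>R x + (t * 0) *\<^sub>R v) * t"
      by (rule DERIV_unique)
    then show ?thesis
      using that by simp
  qed
  have "dderiv f v (t *\<^sub>R x) = t ^ N * dderiv f v x" for t x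
  proof (cases "t = 0")
    case True
    have c: "continuous_on UNIV (\<lambda>t. dderiv f v (t *\<^sub>R x) - t ^ N * dderiv f v x)"
      by (intro continuous_intros
          continuous_on_compose2[OF continuous_on_real_polynomial_function[OF polyd]]) auto
    then have "closed ((\<lambda>t. dderiv f v (t *\<^sub>R x) - t ^ N * dderiv f v x) -` {0})"
      by (intro continuous_closed_vimage) (auto simp: continuous_on_eq_continuous_at)
    then have "closure (- {0}) \<subseteq> (\<lambda>t. dderiv f v (t *\<^sub>R x) - t ^ N * dderiv f v x) -` {0}"
      by (intro closure_minimal) (auto simp: nz)
    moreover have "(0::real) \<in> closure (- {0})"
      by (simp add: closure_complement)
    ultimately have "0 \<in> (\<lambda>t. dderiv f v (t *\<^sub>R x) - t ^ N * dderiv f v x) -` {0}"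
      by (rule subsetD)
    then show ?thesis
      using True by simp
  qed (simp add: nz)
  with polyd show ?thesis
    by (simp add: homogeneous_poly_def)
qed

lemma homogeneous_poly_euler:
  fixes f :: "'a::euclidean_space \<Rightarrow> real"
  assumes f: "homogeneous_poly N f"
  shows "dderiv f x x = real N * f x"
proof -
  have poly: "real_polynomial_function f"
    using f by (simp add: homogeneous_poly_def)
  have "f (x + t *\<^sub>R x) = (1 + t) ^ N * f x" for t
    using homogeneous_poly_scale[OF f, of "1 + t" x] by (simp add: scaleR_add_left)
  then have "((\<lambda>t. (1 + t) ^ N * f x) has_real_derivative dderiv f x (x + 0 *\<^sub>R x)) (at 0)"
    using dderiv_line[OF poly, of x x 0] by simp
  moreover have "((\<lambda>t. (1 + t) ^ N * f x) has_real_derivative real N * f x) (at 0)"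
    by (auto intro!: derivative_eq_intros)
  ultimately show ?thesis
    using DERIV_unique by fastforce
qed

lemma dderiv_root_sum:
  assumes poly: "real_polynomial_function f"
    and \<mu>: "\<And>t. f (y + t *\<^sub>R v) = c * (\<Prod>j<N. t + \<mu> j)"
  shows "dderiv f v (y + t *\<^sub>R v) = c * (\<Sum>j<N. \<Prod>k\<in>{..<N} - {j}. t + \<mu> k)"
proof -
  have "((\<lambda>t. c * (\<Prod>j<N. t + \<mu> j)) has_real_derivative
      c * (\<Sum>j<N. \<Prod>k\<in>{..<N} - {j}. t + \<mu> k)) (at t)"
  proof (rule DERIV_cmult)
    have "((\<lambda>t. \<Prod>j<N. t + \<mu> j) has_derivative
        (\<lambda>s. \<Sum>j<N. s * (\<Prod>k\<in>{..<N} - {j}. t + \<mu> k))) (at t)"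
      by (rule has_derivative_prod) (auto intro!: derivative_eq_intros)
    then show "((\<lambda>t. \<Prod>j<N. t + \<mu> j) has_real_derivative
        (\<Sum>j<N. \<Prod>k\<in>{..<N} - {j}. t + \<mu> k)) (at t)"
      by (simp add: has_field_derivative_def mult_commute_abs flip: sum_distrib_left)
  qed
  moreover have "((\<lambda>t. c * (\<Prod>j<N. t + \<mu> j)) has_real_derivative dderiv f v (y + t *\<^sub>R v)) (at t)"
    using dderiv_line[OF poly, of y v t] by (simp add: \<mu>)
  ultimately show ?thesis
    using DERIV_unique by blast
qed

text \<open>At b in \<open>S\<close> the derivative is f(v) times an elementary symmetric function
  of positive eigenvalues. Along \<open>v\<close> itself it stays real-rooted by the Gauss-Lucas
  argument, and \<open>garding_onI\<close> spreads this to all of \<open>S\<close>.\<close>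

lemma garding_on_dderiv:
  fixes f :: "'a::euclidean_space \<Rightarrow> real"
  assumes f: "garding_on (Suc N) f S" and v: "v \<in> S"
  shows "garding_on N (dderiv f v) S"
proof (rule garding_onI[OF _ _ _ v])
  have hf: "homogeneous_poly (Suc N) f" and S: "connected S" and hyp: "hyperbolic_along (Suc N) f v"
    using f v by (auto simp: garding_on_def)
  have poly: "real_polynomial_function f"
    using hf by (simp add: homogeneous_poly_def)
  have fv: "0 < f v"
    using f v by (rule garding_on_pos)
  show hd: "homogeneous_poly N (dderiv f v)"
    using hf by (rule homogeneous_poly_dderiv)
  show "connected S" by fact
  show pos: "0 < dderiv f v b" if b: "b \<in> S" for b
  proof -
    obtain \<mu> where \<mu>: "\<And>t. f (b + t *\<^sub>R v) = f v * (\<Prod>j<Suc N. t + \<mu> j)" "\<And>j. j < Suc N \<Longrightarrow> 0 < \<mu> j"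
      using garding_on_decompose[OF f v b] by blast
    have "dderiv f v (b + 0 *\<^sub>R v) = f v * (\<Sum>j<Suc N. \<Prod>k\<in>{..<Suc N} - {j}. 0 + \<mu> k)"
      by (rule dderiv_root_sum[OF poly \<mu>(1)])
    moreover have "0 < (\<Sum>j<Suc N. \<Prod>k\<in>{..<Suc N} - {j}. 0 + \<mu> k)"
      using \<mu>(2) by (intro sum_pos prod_pos) auto
    ultimately show ?thesis
      using fv by simp
  qed
  show "hyperbolic_along N (dderiv f v) v"
  proof (rule hyperbolic_alongI_poly[of N "dderiv f v", OF hd pos[OF v]])
    fix y
    obtain \<mu> where \<mu>: "\<And>t. f (y + t *\<^sub>R v) = f v * (\<Prod>j<Suc N. t + \<mu> j)"
      using hyp unfolding hyperbolic_along_def by blast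
    define q where "q = smult (f v) (\<Sum>j<Suc N. \<Prod>k\<in>{..<Suc N} - {j}. [:\<mu> k, 1:])"
    have "poly q t = dderiv f v (y + t *\<^sub>R v)" for t
      by (simp only: dderiv_root_sum[OF poly \<mu>] q_def) (simp add: poly_sum poly_prod add.commute del: sum.lessThan_Suc)
    moreover have "z \<in> \<real>" if root: "poly (map_poly of_real q) z = 0" for z :: complex
    proof (rule ccontr)
      assume "z \<notin> \<real>"
      then have z: "Im z \<noteq> 0"
        by (simp add: complex_is_Real_iff)
      then have nz: "z + of_real (\<mu> j) \<noteq> 0" for j
        by (simp add: complex_eq_iff)
      have "map_poly of_real q = smult (of_real (f v)) (\<Sum>j<Suc N. \<Prod>k\<in>{..<Suc N} - {j}. [:complex_of_real (\<mu> k), 1:])"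
        by (rule complex_poly_eqI_real)
           (simp add: poly_map_poly_of_real q_def poly_prod poly_sum del: sum.lessThan_Suc)
      with root fv have "0 = (\<Sum>j<Suc N. \<Prod>k\<in>{..<Suc N} - {j}. z + of_real (\<mu> k))"
        by (simp add: poly_prod poly_sum add.commute del: sum.lessThan_Suc)
      \<comment> \<open>Passing to the logarithmic derivative: the sum of 1/(z + \<mu>_j) has
        imaginary part -Im z times a sum of positive terms, so it cannot vanish off the real
        axis.\<close>
      also have "\<dots> = (\<Sum>j<Suc N. (\<Prod>k<Suc N. z + of_real (\<mu> k)) * inverse (z + of_real (\<mu> j)))"
        using nz by (intro sum.cong refl) (simp add: prod_diff1 divide_inverse del: prod.lessThan_Suc)
      also have "\<dots> = (\<Prod>k<Suc N. z + of_real (\<mu> k)) * (\<Sum>j<Suc N. inverse (z + of_real (\<mu> j)))"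
        by (simp only: sum_distrib_left)
      finally have "(\<Sum>j<Suc N. inverse (z + of_real (\<mu> j))) = 0"
        using nz by (simp del: sum.lessThan_Suc)
      then have "Im (\<Sum>j<Suc N. inverse (z + of_real (\<mu> j))) = 0"
        by simp
      then have "- Im z * (\<Sum>j<Suc N. inverse ((cmod (z + of_real (\<mu> j)))\<^sup>2)) = 0"
        by (simp add: sum_distrib_left cmod_power2 divide_inverse del: sum.lessThan_Suc)
      moreover have "0 < (\<Sum>j<Suc N. inverse ((cmod (z + of_real (\<mu> j)))\<^sup>2))"
        using nz by (intro sum_pos) auto
      ultimately show False
        using z by auto
    qed
    ultimately show "\<exists>p. (\<forall>t. poly p t = dderiv f v (y + t *\<^sub>R v)) \<and>
        (\<forall>z::complex. poly (map_poly of_real p) z = 0 \<longrightarrow> z \<in> \<real>)"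
      by blast
  qed
qed

text \<open>
  The tangent inequality \<open>\<psi>(1) \<ge> \<psi>(0) exp (\<psi>'(0) / \<psi>(0))\<close> of a log-convex function, in the form
  that is linear in \<open>\<psi>\<close> for each \<open>L\<close> and therefore passes through sums in the induction.
\<close>

lemma garding_exp_tangent_aux:
  fixes f :: "'a::euclidean_space \<Rightarrow> real"
  assumes "garding_on N f S" and I: "finite I" "I \<noteq> {}" and v: "\<And>i. i \<in> I \<Longrightarrow> v i \<in> S"
    and "((\<lambda>t. f (\<Sum>i\<in>I. exp (t * l i) *\<^sub>R v i)) has_real_derivative d) (at 0)"
  shows "exp L * (f (\<Sum>i\<in>I. v i) * (1 - L) + d) \<le> f (\<Sum>i\<in>I. exp (l i) *\<^sub>R v i)"
  using assms(1,5)
proof (induction N arbitrary: f L d)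
  case 0
  have const: "f x = f 0" for x
    using homogeneous_poly_scale[of 0 f 0 x] 0 by (simp add: garding_on_def)
  obtain i where "i \<in> I" using I by blast
  then have "0 < f 0"
    using garding_on_pos[OF 0(1) v] const by metis
  moreover have "(\<lambda>t. f (\<Sum>i\<in>I. exp (t * l i) *\<^sub>R v i)) = (\<lambda>t. f 0)"
    by (rule ext) (rule const)
  then have "d = 0"
    using 0(2) DERIV_unique[OF _ DERIV_const] by fastforce
  moreover have "exp L * (1 - L) \<le> 1"
  proof -
    have "exp L * (1 - L) \<le> exp L * exp (- L)"
      using exp_ge_add_one_self[of "- L"] by (intro mult_left_mono) auto
    then show ?thesis by (simp flip: exp_add)
  qed
  ultimately show ?case
    using mult_left_mono[of "exp L * (1 - L)" 1 "f 0"]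
    by (simp add: const[of "sum _ _"] algebra_simps)
next
  case (Suc N)
  let ?x = "\<lambda>t. \<Sum>i\<in>I. exp (t * l i) *\<^sub>R v i"
  have hf: "homogeneous_poly (Suc N) f"
    using Suc.prems by (simp add: garding_on_def)
  then have poly: "real_polynomial_function f"
    by (simp add: homogeneous_poly_def)
  define \<phi> where "\<phi> i = dderiv f (v i)" for i
  \<comment> \<open>Euler's formula reduces \<open>f\<close> to the derivatives \<phi>_i, of degree
    one less, with weights c_i. These are positive in the uses c_i = exp(l_i) and c_i = 1, so
    inequalities for the \<phi>_i can be added up.\<close>
  have euler: "f (\<Sum>i\<in>I. c i *\<^sub>R v i) = (\<Sum>i\<in>I. c i * \<phi> i (\<Sum>i\<in>I. c i *\<^sub>R v i)) / Suc N" for c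
  proof -
    let ?y = "\<Sum>i\<in>I. c i *\<^sub>R v i"
    have lin: "linear (\<lambda>w. dderiv f w ?y)"
      using dderiv_has_derivative[OF poly] by (rule has_derivative_linear)
    have "real (Suc N) * f ?y = (\<Sum>i\<in>I. c i * \<phi> i ?y)"
      unfolding homogeneous_poly_euler[OF hf, symmetric]
      by (subst linear_sum[OF lin]) (simp add: linear_scale[OF lin] \<phi>_def)
    then show ?thesis
      by (simp add: field_simps)
  qed
  have g: "garding_on N (\<phi> i) S" if "i \<in> I" for i
    unfolding \<phi>_def using garding_on_dderiv Suc.prems(1) v that by blast
  have "\<exists>d. ((\<lambda>t. \<phi> i (?x t)) has_real_derivative d) (at 0)" for i
  proof -
    have "\<phi> i differentiable at (?x 0)"
      unfolding \<phi>_def using poly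
      by (intro differentiable_at_real_polynomial_function real_polynomial_function_dderiv)
    moreover have "?x differentiable at 0"
    proof (rule differentiableI)
      show "(?x has_derivative (\<lambda>s. s *\<^sub>R (\<Sum>i\<in>I. l i *\<^sub>R v i))) (at 0)"
        by (auto intro!: derivative_eq_intros simp: scaleR_sum_right)
    qed
    ultimately have "(\<lambda>t. \<phi> i (?x t)) differentiable at 0"
      using differentiable_chain_at[of ?x 0 "\<phi> i"] by (simp add: o_def)
    then show ?thesis
      by (simp add: real_differentiable_def)
  qed
  then have "\<exists>\<delta>. \<forall>i. ((\<lambda>t. \<phi> i (?x t)) has_real_derivative \<delta> i) (at 0)"
    by (intro choice allI)
  then obtain \<delta> where \<delta>: "\<And>i. ((\<lambda>t. \<phi> i (?x t)) has_real_derivative \<delta> i) (at 0)"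
    by (elim exE) (rule that, erule spec)
  have "((\<lambda>t. (\<Sum>i\<in>I. exp (t * l i) * \<phi> i (?x t)) / Suc N) has_real_derivative
      (\<Sum>i\<in>I. l i * \<phi> i (\<Sum>i\<in>I. v i) + \<delta> i) / Suc N) (at 0)"
  proof (intro DERIV_cdivide DERIV_sum)
    fix i
    have "((\<lambda>t. exp (t * l i)) has_real_derivative l i) (at 0)"
      by (auto intro!: derivative_eq_intros)
    from DERIV_mult[OF this \<delta>[of i]]
    show "((\<lambda>t. exp (t * l i) * \<phi> i (?x t)) has_real_derivative
        l i * \<phi> i (\<Sum>i\<in>I. v i) + \<delta> i) (at 0)"
      by simp
  qed
  then have d: "d = (\<Sum>i\<in>I. l i * \<phi> i (\<Sum>i\<in>I. v i) + \<delta> i) / Suc N"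
    using DERIV_unique Suc.prems(2) by (simp add: euler)
  have "exp L * (\<phi> i (\<Sum>i\<in>I. v i) * (1 - L) + (l i * \<phi> i (\<Sum>i\<in>I. v i) + \<delta> i))
      \<le> exp (l i) * \<phi> i (\<Sum>i\<in>I. exp (l i) *\<^sub>R v i)" if i: "i \<in> I" for i
  proof -
    \<comment> \<open>The induction hypothesis is taken at \<open>L - l i\<close>: the factor
      \<open>exp (l i)\<close> restores \<open>exp L\<close>, and the shift in 1 - L produces the
      product-rule term \<open>l i * \<phi> i\<close>.\<close>
    have "exp (l i) * (exp (L - l i) * (\<phi> i (\<Sum>i\<in>I. v i) * (1 - (L - l i)) + \<delta> i))
      \<le> exp (l i) * \<phi> i (\<Sum>i\<in>I. exp (l i) *\<^sub>R v i)"
      using Suc.IH[OF g[OF i] \<delta>] by (intro mult_left_mono) auto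
    then show ?thesis
      by (simp add: exp_diff algebra_simps)
  qed
  then have "(\<Sum>i\<in>I. exp L * (\<phi> i (\<Sum>i\<in>I. v i) * (1 - L) + (l i * \<phi> i (\<Sum>i\<in>I. v i) + \<delta> i))) / Suc N
      \<le> (\<Sum>i\<in>I. exp (l i) * \<phi> i (\<Sum>i\<in>I. exp (l i) *\<^sub>R v i)) / Suc N"
    by (intro divide_right_mono sum_mono) auto
  moreover have "(\<Sum>i\<in>I. exp L * (\<phi> i (\<Sum>i\<in>I. v i) * (1 - L) + (l i * \<phi> i (\<Sum>i\<in>I. v i) + \<delta> i))) / Suc N
    = exp L * ((\<Sum>i\<in>I. \<phi> i (\<Sum>i\<in>I. v i)) / Suc N * (1 - L) + d)"
    unfolding d by (simp add: sum.distrib sum_distrib_left sum_distrib_right sum_divide_distrib distrib_left add_divide_distrib)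
  ultimately show ?case
    using euler[of "\<lambda>i. exp (l i)"] euler[of "\<lambda>i. 1"] by simp
qed

lemma garding_exp_tangent:
  fixes f :: "'a::euclidean_space \<Rightarrow> real"
  assumes f: "garding_on N f S" and I: "finite I" "I \<noteq> {}" and v: "\<And>i. i \<in> I \<Longrightarrow> v i \<in> S"
  shows "exp L * (f (\<Sum>i\<in>I. v i) * (1 - L) + dderiv f (\<Sum>i\<in>I. l i *\<^sub>R v i) (\<Sum>i\<in>I. v i))
    \<le> f (\<Sum>i\<in>I. exp (l i) *\<^sub>R v i)"
proof (rule garding_exp_tangent_aux[OF f I v])
  have poly: "real_polynomial_function f"
    using f by (simp add: garding_on_def homogeneous_poly_def)
  let ?x = "\<lambda>t. \<Sum>i\<in>I. exp (t * l i) *\<^sub>R v i"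
  have "(?x has_derivative (\<lambda>s. s *\<^sub>R (\<Sum>i\<in>I. l i *\<^sub>R v i))) (at 0)"
    by (auto intro!: derivative_eq_intros simp: scaleR_sum_right)
  from has_derivative_compose[OF this dderiv_has_derivative[OF poly]]
  have "((\<lambda>t. f (?x t)) has_derivative (\<lambda>s. dderiv f (s *\<^sub>R (\<Sum>i\<in>I. l i *\<^sub>R v i)) (\<Sum>i\<in>I. v i))) (at 0)"
    by simp
  moreover have "dderiv f (s *\<^sub>R w) y = s * dderiv f w y" for s w y
    using linear_scale[OF has_derivative_linear[OF dderiv_has_derivative[OF poly]]] by simp
  ultimately show "((\<lambda>t. f (?x t)) has_real_derivative
      dderiv f (\<Sum>i\<in>I. l i *\<^sub>R v i) (\<Sum>i\<in>I. v i)) (at 0)"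
    by (simp add: has_field_derivative_def mult_commute_abs)
qed

text \<open>AM-GM for the reciprocals of the eigenvalues of \<open>b\<close> relative to
  \<open>a\<close>: their sum is the logarithmic derivative of \<open>f\<close> at \<open>b\<close>
  along \<open>a\<close>, and their product is f(a) / f(b).\<close>

lemma garding_inequality:
  fixes f :: "'a::euclidean_space \<Rightarrow> real"
  assumes f: "garding_on N f S" and N: "0 < N" and a: "a \<in> S" and b: "b \<in> S"
  shows "real N * f b * (f a / f b) powr (1 / real N) \<le> dderiv f a b"
proof -
  obtain \<mu> where \<mu>: "\<And>t. f (b + t *\<^sub>R a) = f a * (\<Prod>j<N. t + \<mu> j)" "\<And>j. j < N \<Longrightarrow> 0 < \<mu> j"
    using garding_on_decompose[OF f a b] by blast
  have poly: "real_polynomial_function f"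
    using f by (simp add: garding_on_def homogeneous_poly_def)
  have fa: "0 < f a" and fb: "0 < f b"
    using f a b by (auto intro: garding_on_pos)
  have fb_eq: "f b = f a * (\<Prod>j<N. \<mu> j)"
    using \<mu>(1)[of 0] by simp
  have "dderiv f a b = f a * (\<Sum>j<N. \<Prod>k\<in>{..<N} - {j}. \<mu> k)"
    using dderiv_root_sum[OF poly \<mu>(1), of 0] by simp
  also have "\<dots> = f a * (\<Sum>j<N. (\<Prod>k<N. \<mu> k) * (1 / \<mu> j))"
  proof -
    have "(\<Prod>k\<in>{..<N} - {j}. \<mu> k) = (\<Prod>k<N. \<mu> k) * (1 / \<mu> j)" if "j < N" for j
      using \<mu>(2)[OF that] that by (simp add: prod_diff1)
    then show ?thesis by simp
  qed
  also have "\<dots> = f b * (\<Sum>j<N. 1 / \<mu> j)"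
    by (simp add: fb_eq sum_distrib_left)
  also have "\<dots> = real N * f b * (\<Sum>j\<in>{..<N}. (1 / \<mu> j) / card {..<N})"
    using N by (simp only: sum_divide_distrib[symmetric]) simp
  also have "\<dots> \<ge> real N * f b * (\<Prod>j\<in>{..<N}. 1 / \<mu> j) powr (1 / card {..<N})"
    using N fb \<mu>(2) by (intro mult_left_mono arith_geom_mean) (auto simp: less_imp_le)
  also have "(\<Prod>j\<in>{..<N}. 1 / \<mu> j) = f a / f b"
    using fa by (simp add: fb_eq prod_dividef)
  finally show ?thesis
    by simp
qed

section \<open>The spectral theorem for symmetric matrices\<close>

lemma symmetric_inner_matrix_vector:
  fixes A :: "real^'n^'n"
  assumes "A \<in> sym_mats"
  shows "x \<bullet> (A *v y) = (A *v x) \<bullet> y"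
proof -
  have "A *v x = x v* A"
    using assms transpose_matrix_vector[of A x] by (simp add: sym_mats_def)
  then show ?thesis
    by (simp add: dot_lmul_matrix)
qed

text \<open>A maximizer x of the quadratic form on the unit sphere of \<open>W\<close> is an
  eigenvector: the residual h = A x - \<beta> x lies in \<open>W\<close>, and moving x along h would
  raise the Rayleigh quotient unless h = 0.\<close>

lemma symmetric_eigenvector_ex:
  fixes A :: "real^'n^'n"
  assumes A: "A \<in> sym_mats" and W: "subspace W" "\<And>x. x \<in> W \<Longrightarrow> A *v x \<in> W"
    and ne: "w \<in> W" "w \<noteq> 0"
  shows "\<exists>x \<beta>. x \<in> W \<and> norm x = 1 \<and> A *v x = \<beta> *\<^sub>R x"
proof -
  let ?K = "sphere 0 1 \<inter> W"
  have "compact ?K"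
    using W(1) by (intro compact_Int_closed closed_subspace) auto
  moreover have "w /\<^sub>R norm w \<in> ?K"
    using ne W(1) by (auto simp: subspace_scale)
  moreover have "continuous_on ?K (\<lambda>x. x \<bullet> (A *v x))"
    by (intro continuous_intros)
  ultimately obtain x where x: "x \<in> ?K" and max: "\<And>y. y \<in> ?K \<Longrightarrow> y \<bullet> (A *v y) \<le> x \<bullet> (A *v x)"
    using continuous_attains_sup[of ?K "\<lambda>x. x \<bullet> (A *v x)"] by blast
  define \<beta> where "\<beta> = x \<bullet> (A *v x)"
  have xW: "x \<in> W" and nx: "norm x = 1"
    using x by auto
  have bound: "y \<bullet> (A *v y) \<le> \<beta> * (y \<bullet> y)" if "y \<in> W" for y
  proof (cases "y = 0")
    case False
    have "y /\<^sub>R norm y \<in> ?K"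
      using that False W(1) by (auto simp: subspace_scale)
    from max[OF this] have "(y \<bullet> (A *v y)) / (norm y)\<^sup>2 \<le> \<beta>"
      by (simp add: \<beta>_def matrix_vector_mult_scaleR power2_eq_square divide_inverse mult_ac)
    then show ?thesis
      using False by (simp add: field_simps dot_square_norm)
  qed simp
  define h where "h = A *v x - \<beta> *\<^sub>R x"
  have hW: "h \<in> W"
    unfolding h_def using W xW by (intro subspace_diff subspace_scale) auto
  define C where "C = \<beta> * (h \<bullet> h) - h \<bullet> (A *v h)"
  \<comment> \<open>This is \<open>bound\<close> at x + t h. As h is orthogonal to x, the
    first-order gain is 2 t |h|^2, and \<open>C\<close> collects the second-order terms.\<close>
  have key: "2 * t * (h \<bullet> h) \<le> t\<^sup>2 * C" for t
  proof -
    have xx: "x \<bullet> x = 1"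
      using nx by (simp add: norm_eq_1)
    have Ax: "A *v x = h + \<beta> *\<^sub>R x"
      by (simp add: h_def)
    have xAh: "x \<bullet> (A *v h) = h \<bullet> h + \<beta> * (x \<bullet> h)"
      using symmetric_inner_matrix_vector[OF A, of x h] by (simp add: Ax inner_add_left)
    have xh: "x \<bullet> h = 0"
      by (simp add: h_def inner_diff_right xx \<beta>_def)
    have "x + t *\<^sub>R h \<in> W"
      using W(1) xW hW by (intro subspace_add subspace_scale)
    from bound[OF this] show ?thesis
      using xAh xx xh by (simp add: C_def matrix_vector_right_distrib matrix_vector_mult_scaleR Ax
          inner_add_left inner_add_right inner_commute[of h x] power2_eq_square algebra_simps)
  qed
  have "h = 0"
  proof (rule ccontr)
    assume "h \<noteq> 0"
    then have p: "0 < h \<bullet> h" by simp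
    \<comment> \<open>Small enough that t C \<le> |h|^2, which contradicts \<open>key\<close>
      divided by t.\<close>
    let ?t = "(h \<bullet> h) / (\<bar>C\<bar> + 1)"
    have t: "0 < ?t"
      using p by (simp add: divide_pos_pos)
    have "2 * (h \<bullet> h) \<le> ?t * C"
    proof (rule mult_left_le_imp_le[OF _ t])
      show "?t * (2 * (h \<bullet> h)) \<le> ?t * (?t * C)"
        using key[of ?t] by (simp only: power2_eq_square mult_ac)
    qed
    also have "\<dots> \<le> ?t * (\<bar>C\<bar> + 1)"
      using t by (intro mult_left_mono) auto
    also have "\<dots> = h \<bullet> h"
      by simp
    finally show False
      using p by simp
  qed
  then show ?thesis
    using xW nx by (auto simp: h_def)
qed

definition orthonormal_frame :: "('n \<Rightarrow> real^'n) \<Rightarrow> bool" where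
  "orthonormal_frame u \<longleftrightarrow> (\<forall>i j. u i \<bullet> u j = (if i = j then 1 else 0))"

text \<open>Eigenvectors are added one index at a time. By symmetry the orthogonal complement of
  those already found is invariant under \<open>A\<close>, and it is nonzero while indices
  remain.\<close>

lemma spectral_theorem_frame:
  fixes A :: "real^'n^'n"
  assumes A: "A \<in> sym_mats"
  obtains u d where "orthonormal_frame u" "\<And>i. A *v u i = d i *\<^sub>R u i"
proof -
  have "\<exists>u d. (\<forall>i\<in>J. \<forall>j\<in>J. u i \<bullet> u j = (if i = j then 1 else 0)) \<and> (\<forall>i\<in>J. A *v u i = d i *\<^sub>R u i)"
    if "finite J" for J :: "'n set"
    using that
  proof induction
    case (insert k J)
    then obtain u d where on: "\<And>i j. i \<in> J \<Longrightarrow> j \<in> J \<Longrightarrow> u i \<bullet> u j = (if i = j then 1 else 0)"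
      and ev: "\<And>i. i \<in> J \<Longrightarrow> A *v u i = d i *\<^sub>R u i"
      by blast
    define W where "W = {x. \<forall>i\<in>J. u i \<bullet> x = 0}"
    have "card J < CARD('n)"
      using insert.hyps by (intro psubset_card_mono) auto
    then have "dim (u ` J) < DIM(real^'n)"
      using dim_le_card'[of "u ` J"] card_image_le[of J u] insert.hyps by simp
    then obtain w where w: "w \<noteq> 0" "\<And>y. y \<in> span (u ` J) \<Longrightarrow> orthogonal w y"
      using orthogonal_to_subspace_exists by blast
    have "w \<in> W"
    proof -
      have "orthogonal w (u i)" if "i \<in> J" for i
        using that by (intro w(2) span_base) auto
      then show ?thesis
        by (simp add: W_def orthogonal_def inner_commute)
    qed
    moreover have "subspace W"
      by (auto simp: W_def subspace_def inner_add_right)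
    moreover have "A *v x \<in> W" if "x \<in> W" for x
      using that ev by (auto simp: W_def symmetric_inner_matrix_vector[OF A])
    ultimately obtain x \<beta> where x: "x \<in> W" "norm x = 1" "A *v x = \<beta> *\<^sub>R x"
      using symmetric_eigenvector_ex[OF A] w(1) by metis
    have "\<forall>i\<in>insert k J. \<forall>j\<in>insert k J. (u(k := x)) i \<bullet> (u(k := x)) j = (if i = j then 1 else 0)"
      using x(1,2) on insert.hyps by (auto simp: W_def inner_commute norm_eq_1)
    moreover have "\<forall>i\<in>insert k J. A *v (u(k := x)) i = (d(k := \<beta>)) i *\<^sub>R (u(k := x)) i"
      using x ev insert.hyps by auto
    ultimately show ?case
      by blast
  qed simp
  from this[of UNIV] show ?thesis
    using that by (auto simp: orthonormal_frame_def)
qed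

text \<open>The outer product x x^T; for a unit vector, the orthogonal projection onto its
  line.\<close>

definition rank1 :: "real^'n \<Rightarrow> real^'n^'n" where
  "rank1 x = (\<chi> r c. x $ r * x $ c)"

lemma rank1_mult: "rank1 x *v y = (x \<bullet> y) *\<^sub>R x"
  by (simp add: rank1_def matrix_vector_mult_def vec_eq_iff inner_vec_def sum_distrib_left mult_ac)

lemma trace_mult_rank1: "trace (D ** rank1 x) = x \<bullet> (D *v x)"
  by (simp add: trace_def rank1_def matrix_matrix_mult_def matrix_vector_mult_def inner_vec_def
      sum_distrib_left mult_ac)

lemma trace_mult_sum_rank1:
  "trace (D ** (\<Sum>i\<in>I. a i *\<^sub>R rank1 (u i))) = (\<Sum>i\<in>I. a i * (u i \<bullet> (D *v u i)))"
proof -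
  have "trace (D ** (\<Sum>i\<in>I. a i *\<^sub>R rank1 (u i))) = (\<Sum>i\<in>I. a i * trace (D ** rank1 (u i)))"
  proof -
    have "trace (D ** 0) = 0" "trace (D ** (c *\<^sub>R X)) = c * trace (D ** X)" for c X
      by (simp_all add: trace_def matrix_matrix_mult_def sum_distrib_left mult_ac)
    then show ?thesis
      by (induction I rule: infinite_finite_induct) (simp_all add: matrix_add_ldistrib trace_add)
  qed
  then show ?thesis
    by (simp add: trace_mult_rank1)
qed

lemma frame_decompose:
  fixes u :: "'n \<Rightarrow> real^'n"
  shows "(\<Sum>i\<in>UNIV. a i *\<^sub>R rank1 (u i)) =
    (\<chi> r c. u c $ r) ** (\<chi> i j. if i = j then a i else 0) ** transpose (\<chi> r c. u c $ r)"
  by (simp add: vec_eq_iff matrix_matrix_mult_def rank1_def transpose_def sum_component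
      if_distrib[of "\<lambda>x. _ * x"] cong: if_cong) (simp add: mult_ac)

lemma frame_orthogonal:
  fixes u :: "'n \<Rightarrow> real^'n"
  assumes u: "orthonormal_frame u"
  defines "U \<equiv> (\<chi> r c. u c $ r)"
  shows "transpose U ** U = mat 1" "U ** transpose U = mat 1"
proof -
  show "transpose U ** U = mat 1"
    using u unfolding orthonormal_frame_def inner_vec_def
    by (simp add: vec_eq_iff matrix_matrix_mult_def transpose_def U_def mat_def)
  then show "U ** transpose U = mat 1"
    by (simp add: matrix_left_right_inverse)
qed

lemma frame_sum_one:
  fixes u :: "'n \<Rightarrow> real^'n"
  assumes "orthonormal_frame u"
  shows "(\<Sum>i\<in>UNIV. rank1 (u i)) = mat 1"
proof -
  have "(\<chi> i j. if i = j then 1 else 0) = (mat 1 :: real^'n^'n)"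
    by (simp add: mat_def)
  then show ?thesis
    using frame_decompose[of "\<lambda>i. 1" u] frame_orthogonal(2)[OF assms] by simp
qed

lemma frame_sum_det:
  fixes u :: "'n \<Rightarrow> real^'n"
  assumes "orthonormal_frame u"
  shows "det (\<Sum>i\<in>UNIV. a i *\<^sub>R rank1 (u i)) = (\<Prod>i\<in>UNIV. a i)"
proof -
  let ?U = "(\<chi> r c. u c $ r)"
  have "det ?U * det ?U = det (transpose ?U ** ?U)"
    by (simp only: det_mul det_transpose)
  then have "det ?U * det ?U = 1"
    by (simp only: frame_orthogonal(1)[OF assms] det_I)
  moreover have "det (\<chi> i j. if i = j then a i else 0) = (\<Prod>i\<in>UNIV. a i)"
    by (subst det_diagonal) auto
  ultimately show ?thesis
    by (simp add: frame_decompose det_mul)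
qed

lemma frame_sum_eigen:
  fixes D :: "real^'n^'n"
  assumes u: "orthonormal_frame u" and D: "\<And>i. D *v u i = d i *\<^sub>R u i"
  shows "D = (\<Sum>i\<in>UNIV. d i *\<^sub>R rank1 (u i))"
proof -
  let ?U = "(\<chi> r c. u c $ r) :: real^'n^'n"
  have "D ** ?U = ?U ** (\<chi> i j. if i = j then d i else 0)"
  proof -
    have "(\<Sum>k\<in>UNIV. D $ r $ k * u c $ k) = u c $ r * d c" for r c
      using D[of c] by (simp add: vec_eq_iff matrix_vector_mult_def mult.commute)
    then show ?thesis
      by (simp add: vec_eq_iff matrix_matrix_mult_def if_distrib[of "\<lambda>x. _ * x"] cong: if_cong)
  qed
  then have "D ** (?U ** transpose ?U) = (\<Sum>i\<in>UNIV. d i *\<^sub>R rank1 (u i))"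
    by (simp add: matrix_mul_assoc frame_decompose)
  then show ?thesis
    by (simp add: frame_orthogonal(2)[OF u])
qed

lemma sum_rank1_sym: "(\<Sum>i\<in>I. a i *\<^sub>R rank1 (u i)) \<in> sym_mats"
  by (simp add: sym_mats_def transpose_def rank1_def vec_eq_iff sum_component mult_ac)

lemma sum_rank1_mult_vec:
  "(\<Sum>i\<in>I. a i *\<^sub>R rank1 (u i)) *v x = (\<Sum>i\<in>I. (a i * (u i \<bullet> x)) *\<^sub>R u i)"
  by (induction I rule: infinite_finite_induct)
     (simp_all add: matrix_vector_mult_add_rdistrib rank1_mult scaleR_matrix_vector_assoc[symmetric])

lemma frame_sum_pos_def:
  fixes u :: "'n \<Rightarrow> real^'n"
  assumes u: "orthonormal_frame u" and a: "\<And>i. 0 < a i"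
  shows "pos_def (\<Sum>i\<in>UNIV. a i *\<^sub>R rank1 (u i))"
  unfolding pos_def_def
proof (intro conjI allI impI sum_rank1_sym)
  fix x :: "real^'n" assume x: "x \<noteq> 0"
  have quad: "x \<bullet> ((\<Sum>i\<in>UNIV. c i *\<^sub>R rank1 (u i)) *v x) = (\<Sum>i\<in>UNIV. c i * (u i \<bullet> x)\<^sup>2)" for c
    by (simp add: sum_rank1_mult_vec inner_sum_right inner_commute power2_eq_square mult_ac)
  have "(\<Sum>i\<in>UNIV. (u i \<bullet> x)\<^sup>2) = x \<bullet> x"
    using quad[of "\<lambda>i. 1"] by (simp add: frame_sum_one[OF u])
  with x have "(\<Sum>i\<in>UNIV. (u i \<bullet> x)\<^sup>2) \<noteq> 0"
    by simp
  then have "\<exists>i. u i \<bullet> x \<noteq> 0"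
    by (rule contrapos_np) simp
  then obtain i where "u i \<bullet> x \<noteq> 0" ..
  then have "0 < (\<Sum>i\<in>UNIV. a i * (u i \<bullet> x)\<^sup>2)"
    using a by (intro sum_pos2[where i = i]) (auto simp: less_imp_le)
  then show "0 < x \<bullet> ((\<Sum>i\<in>UNIV. a i *\<^sub>R rank1 (u i)) *v x)"
    by (simp add: quad)
qed

text \<open>Testing the bound on matrices diagonal in an eigenframe of \<open>D\<close> reduces it
  to c (\<Prod> a_i)^(1/n) \<le> \<Sum> a_i d_i for all positive a_i.\<close>

lemma pos_def_of_trace_bound:
  fixes D :: "real^'n^'n"
  assumes D: "D \<in> sym_mats" and c: "0 < c"
    and bound: "\<And>A. pos_def A \<Longrightarrow> c * det A powr (1 / CARD('n)) \<le> trace (D ** A)"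
  shows "pos_def D \<and> c ^ CARD('n) / real CARD('n) ^ CARD('n) \<le> det D"
proof -
  let ?n = "CARD('n)"
  obtain u d where u: "orthonormal_frame u" and d: "\<And>i. D *v u i = d i *\<^sub>R u i"
    using spectral_theorem_frame[OF D] by blast
  have uu: "u i \<bullet> u i = 1" for i
    using u by (simp add: orthonormal_frame_def)
  have D_eq: "D = (\<Sum>i\<in>UNIV. d i *\<^sub>R rank1 (u i))"
    using u d by (rule frame_sum_eigen)
  have key: "c * (\<Prod>i\<in>UNIV. a i) powr (1 / ?n) \<le> (\<Sum>i\<in>UNIV. a i * d i)"
    if "\<And>i. 0 < a i" for a
    using bound[OF frame_sum_pos_def[OF u that]]
    by (simp add: frame_sum_det[OF u] trace_mult_sum_rank1 d uu)
  have root: "(y powr (1 / ?n)) ^ ?n = y" if "0 < y" for y :: real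
    using that by (simp add: powr_power)
  have pos: "0 < d k" for k
  proof (rule ccontr)
    assume dk: "\<not> 0 < d k"
    define R where "R = (\<Sum>i\<in>UNIV - {k}. \<bar>d i\<bar>)"
    \<comment> \<open>Weight \<open>T\<close> on index k and 1 elsewhere makes the left side c
      T^(1/n) = R + 1, while for d_k \<le> 0 the right side is at most \<open>R\<close>.\<close>
    define T where "T = ((R + 1) / c) ^ ?n"
    have R: "0 \<le> R"
      by (simp add: R_def sum_nonneg)
    have T: "0 < T"
      using R c by (simp add: T_def)
    have "T powr (1 / ?n) = (R + 1) / c"
      using R c by (simp add: T_def powr_powr flip: powr_realpow)
    then have "R + 1 = c * T powr (1 / ?n)"
      using c by simp
    also have "T = (\<Prod>i\<in>UNIV. if i = k then T else 1)"
      by simp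
    also have "c * \<dots> powr (1 / ?n) \<le> (\<Sum>i\<in>UNIV. (if i = k then T else 1) * d i)"
      using T by (intro key) auto
    also have "\<dots> = T * d k + (\<Sum>i\<in>UNIV - {k}. (if i = k then T else 1) * d i)"
      by (subst sum.remove[of UNIV k]) auto
    also have "(\<Sum>i\<in>UNIV - {k}. (if i = k then T else 1) * d i) \<le> R"
      unfolding R_def by (intro sum_mono) auto
    also have "T * d k \<le> 0"
      using T dk by (simp add: mult_nonneg_nonpos)
    finally show False
      by simp
  qed
  have detD: "det D = (\<Prod>i\<in>UNIV. d i)"
    by (subst D_eq) (rule frame_sum_det[OF u])
  have dpos: "0 < det D"
    unfolding detD using pos by (intro prod_pos) auto
  \<comment> \<open>The weights 1 / d_i amount to testing with the inverse of \<open>D\<close>; the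
    trace becomes n.\<close>
  have "c * (1 / det D) powr (1 / ?n) \<le> (\<Sum>i\<in>UNIV. (1 / d i) * d i)"
    using key[of "\<lambda>i. 1 / d i"] pos by (simp add: prod_dividef detD)
  also have "\<dots> = real ?n"
    using pos by (simp add: less_imp_neq[THEN not_sym])
  finally have "(c * (1 / det D) powr (1 / ?n)) ^ ?n \<le> real ?n ^ ?n"
    using c by (intro power_mono) auto
  then have "c ^ ?n * (1 / det D) \<le> real ?n ^ ?n"
    using root[of "1 / det D"] dpos by (simp add: power_mult_distrib)
  then have "c ^ ?n / real ?n ^ ?n \<le> det D"
    using dpos by (simp add: field_simps)
  moreover have "pos_def D"
    unfolding D_eq using u pos by (rule frame_sum_pos_def)
  ultimately show ?thesis
    by simp
qed

section \<open>Polynomials on symmetric matrices\<close>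

definition sym_part :: "real^'n^'n \<Rightarrow> real^'n^'n" where
  "sym_part X = (1/2) *\<^sub>R (X + transpose X)"

lemma bounded_linear_sym_part: "bounded_linear sym_part"
proof -
  have "linear (sym_part :: real^'n^'n \<Rightarrow> real^'n^'n)"
    by (intro linearI) (simp_all add: sym_part_def transpose_def vec_eq_iff algebra_simps)
  then show ?thesis
    by (simp add: linear_conv_bounded_linear)
qed

lemma sym_part_in: "sym_part X \<in> sym_mats"
  by (simp add: sym_part_def sym_mats_def transpose_def vec_eq_iff)

lemma sym_part_id: "X \<in> sym_mats \<Longrightarrow> sym_part X = X"
  by (simp add: sym_part_def sym_mats_def flip: scaleR_2)

lemma mat_1_sym: "mat 1 \<in> sym_mats"
  by (simp add: sym_mats_def)

lemma garding_cone_subset: "garding_cone g \<subseteq> {A \<in> sym_mats. 0 < g A}"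
  unfolding garding_cone_def by (rule connected_component_subset)

text \<open>Composing with the orthogonal projection onto \<open>sym_mats\<close> gives a polynomial
  on the whole matrix space, where the Euclidean results above apply.\<close>

definition sym_lift :: "(real^'n^'n \<Rightarrow> real) \<Rightarrow> real^'n^'n \<Rightarrow> real" where
  "sym_lift g X = g (sym_part X)"

lemma sym_lift_eq: "A \<in> sym_mats \<Longrightarrow> sym_lift g A = g A"
  by (simp add: sym_lift_def sym_part_id)

lemma homogeneous_poly_sym_lift:
  assumes "homogeneous_polynomial N g"
  shows "homogeneous_poly N (sym_lift g)"
proof -
  interpret S: bounded_linear sym_part
    by (rule bounded_linear_sym_part)
  obtain p where p: "real_polynomial_function p" "\<And>A. A \<in> sym_mats \<Longrightarrow> g A = p A"
    using assms by (auto simp: homogeneous_polynomial_def)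
  have "sym_lift g = p \<circ> sym_part"
    by (simp add: fun_eq_iff sym_lift_def p(2) sym_part_in)
  moreover have "real_polynomial_function (p \<circ> sym_part)"
    using p(1) bounded_linear_sym_part
    by (intro real_polynomial_function_compose polynomial_function_bounded_linear)
  moreover have "sym_lift g (t *\<^sub>R X) = t ^ N * sym_lift g X" for t X
    using assms sym_part_in[of X] by (simp add: sym_lift_def S.scaleR homogeneous_polynomial_def)
  ultimately show ?thesis
    by (simp add: homogeneous_poly_def)
qed

text \<open>Along a line Y + t I the lift sees only the symmetric part of Y, so I-hyperbolicity of
  \<open>g\<close> gives hyperbolicity of the lift along I in the full space.\<close>

lemma garding_on_sym_lift:
  assumes "I_hyperbolic N g"
  shows "garding_on N (sym_lift g) (garding_cone g)"
proof (rule garding_onI)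
  interpret S: bounded_linear sym_part
    by (rule bounded_linear_sym_part)
  have g1: "0 < g (mat 1)" and hg: "homogeneous_polynomial N g"
    using assms by (auto simp: I_hyperbolic_def)
  show h: "homogeneous_poly N (sym_lift g)"
    using hg by (rule homogeneous_poly_sym_lift)
  show "connected (garding_cone g)"
    by (simp add: garding_cone_def)
  show "0 < sym_lift g A" if "A \<in> garding_cone g" for A
    using that garding_cone_subset[of g] by (auto simp: sym_lift_eq)
  show "mat 1 \<in> garding_cone g"
    using g1 by (simp add: garding_cone_def mat_1_sym)
  show "hyperbolic_along N (sym_lift g) (mat 1)"
  proof (rule hyperbolic_alongI_poly[of N "sym_lift g", OF h])
    show "0 < sym_lift g (mat 1)"
      using g1 by (simp add: sym_lift_eq mat_1_sym)
    fix Y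
    have "sym_lift g (Y + t *\<^sub>R mat 1) = g (t *\<^sub>R mat 1 + sym_part Y)" for t
      by (simp add: sym_lift_def S.add S.scaleR sym_part_id mat_1_sym add.commute)
    then show "\<exists>p. (\<forall>t. poly p t = sym_lift g (Y + t *\<^sub>R mat 1)) \<and>
        (\<forall>z::complex. poly (map_poly of_real p) z = 0 \<longrightarrow> z \<in> \<real>)"
      using assms sym_part_in[of Y] by (simp add: I_hyperbolic_def)
  qed
qed

text \<open>\<open>G0\<close> is the ambient gradient of the lift and \<open>G\<close> its symmetric
  part. The lift is blind to antisymmetric directions, so \<open>G\<close> represents the same
  derivative.\<close>

lemma sym_gradient_ex:
  fixes g :: "real^'n^'n \<Rightarrow> real"
  assumes hg: "homogeneous_polynomial N g" and B: "B \<in> sym_mats"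
  obtains G where "has_sym_gradient g G B" "\<And>H. dderiv (sym_lift g) H B = trace (G ** H)"
proof -
  interpret S: bounded_linear sym_part
    by (rule bounded_linear_sym_part)
  let ?f = "sym_lift g"
  have poly: "real_polynomial_function ?f"
    using homogeneous_poly_sym_lift[OF hg] by (simp add: homogeneous_poly_def)
  note der = dderiv_has_derivative[OF poly]
  have lin: "linear (\<lambda>H. dderiv ?f H B)"
    using der by (rule has_derivative_linear)
  define G0 where "G0 = (\<Sum>b\<in>Basis. dderiv ?f b B *\<^sub>R b)"
  have G0: "dderiv ?f H B = G0 \<bullet> H" for H
  proof -
    have "dderiv ?f H B = dderiv ?f (\<Sum>b\<in>Basis. (H \<bullet> b) *\<^sub>R b) B"
      by (simp add: euclidean_representation)
    also have "\<dots> = (\<Sum>b\<in>Basis. (H \<bullet> b) * dderiv ?f b B)"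
      by (subst linear_sum[OF lin]) (simp add: linear_scale[OF lin])
    also have "\<dots> = G0 \<bullet> H"
      by (simp add: G0_def inner_sum_left inner_commute[of H] mult.commute)
    finally show ?thesis .
  qed
  define G where "G = sym_part G0"
  have trace: "trace (G ** H) = G \<bullet> H" for H
  proof -
    have "G $ i $ j = G $ j $ i" for i j
      by (simp add: G_def sym_part_def transpose_def add.commute)
    then have "G \<bullet> H = (\<Sum>j\<in>UNIV. \<Sum>i\<in>UNIV. G $ j $ i * H $ i $ j)"
      by (subst sum.swap) (simp add: inner_vec_def)
    then show ?thesis
      by (simp add: trace_def matrix_matrix_mult_def)
  qed
  have "dderiv ?f H B = trace (G ** H)" for H
  proof -
    have "?f (B + t *\<^sub>R H) = ?f (B + t *\<^sub>R sym_part H)" for t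
      by (simp add: sym_lift_def S.add S.scaleR sym_part_id[OF sym_part_in])
    then have "((\<lambda>t. ?f (B + t *\<^sub>R H)) has_real_derivative dderiv ?f (sym_part H) (B + 0 *\<^sub>R sym_part H)) (at 0)"
      using dderiv_line[OF poly, of B "sym_part H" 0] by simp
    then have "dderiv ?f H B = dderiv ?f (sym_part H) B"
      using DERIV_unique[OF dderiv_line[OF poly, of B H 0]] by simp
    also have "\<dots> = G0 \<bullet> sym_part H"
      by (rule G0)
    also have "\<dots> = G \<bullet> H"
    proof -
      have "G0 \<bullet> transpose H = transpose G0 \<bullet> H"
        by (simp add: inner_vec_def transpose_def) (rule sum.swap)
      then show ?thesis
        by (simp add: G_def sym_part_def inner_add_left inner_add_right)
    qed
    finally show ?thesis
      by (simp add: trace)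
  qed
  moreover have "has_sym_gradient g G B"
    unfolding has_sym_gradient_def
  proof (intro conjI B)
    show "G \<in> sym_mats"
      by (simp add: G_def sym_part_in)
    have "(?f has_derivative (\<lambda>H. trace (G ** H))) (at B within sym_mats)"
      using der[of B] calculation by (simp add: has_derivative_at_withinI)
    then show "(g has_derivative (\<lambda>H. trace (G ** H))) (at B within sym_mats)"
      using B by (rule_tac has_derivative_transform[of _ _ _ ?f]) (auto simp: sym_lift_eq)
  qed
  ultimately show ?thesis
    using that by blast
qed

section \<open>The central gradient at the identity and the determinant inequality\<close>

lemma central_dderiv:
  fixes g :: "real^'n^'n \<Rightarrow> real"
  assumes hg: "homogeneous_polynomial N g" and k: "has_sym_gradient g (k *\<^sub>R mat 1) (mat 1)"
  shows "dderiv (sym_lift g) H (mat 1) = k * trace H"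
proof -
  obtain G where G: "has_sym_gradient g G (mat 1)"
    "\<And>H. dderiv (sym_lift g) H (mat 1) = trace (G ** H)"
    using sym_gradient_ex[OF hg mat_1_sym] by blast
  have "G = k *\<^sub>R mat 1"
    using G(1) k by (rule has_sym_gradient_unique)
  then show ?thesis
    using G(2)[of H]
    by (simp add: scalar_matrix_assoc[symmetric] trace_def sum_distrib_left)
qed

text \<open>Euler's formula at I in the direction I. It makes k / g(I) = N / n, the exponent of the
  determinant below, and excludes N = 0 when k > 0.\<close>

lemma central_euler:
  fixes g :: "real^'n^'n \<Rightarrow> real"
  assumes hg: "homogeneous_polynomial N g" and k: "has_sym_gradient g (k *\<^sub>R mat 1) (mat 1)"
  shows "k * real CARD('n) = real N * g (mat 1)"
  using homogeneous_poly_euler[OF homogeneous_poly_sym_lift[OF hg], of "mat 1"]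
  by (simp add: central_dderiv[OF hg k] trace_I sym_lift_eq mat_1_sym)

lemma det_majorization:
  fixes g :: "real^'n^'n \<Rightarrow> real"
  assumes g: "garding_dirichlet N g" and k: "has_sym_gradient g (k *\<^sub>R mat 1) (mat 1)"
    and A: "pos_def A"
  shows "g (mat 1) * det A powr (real N / CARD('n)) \<le> g A"
proof -
  let ?f = "sym_lift g" and ?n = "CARD('n)" and ?I = "mat 1 :: real^'n^'n"
  have hyp: "I_hyperbolic N g" and sub: "\<And>A. pos_def A \<Longrightarrow> A \<in> garding_cone g"
    using g by (auto simp: garding_dirichlet_def)
  then have hg: "homogeneous_polynomial N g" and g1: "0 < g ?I"
    by (auto simp: I_hyperbolic_def)
  note gard = garding_on_sym_lift[OF hyp]
  have hf: "homogeneous_poly N ?f"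
    using hg by (rule homogeneous_poly_sym_lift)
  then have poly: "real_polynomial_function ?f"
    by (simp add: homogeneous_poly_def)
  have A_sym: "A \<in> sym_mats"
    using A by (simp add: pos_def_def)
  obtain u d where u: "orthonormal_frame u" and d: "\<And>i. A *v u i = d i *\<^sub>R u i"
    using spectral_theorem_frame[OF A_sym] by blast
  have uu: "u i \<bullet> u i = 1" for i
    using u by (simp add: orthonormal_frame_def)
  have A_eq: "A = (\<Sum>i\<in>UNIV. d i *\<^sub>R rank1 (u i))"
    using u d by (rule frame_sum_eigen)
  have dpos: "0 < d i" for i
  proof -
    have "u i \<noteq> 0"
      using uu[of i] by auto
    then have "0 < u i \<bullet> (A *v u i)"
      using A by (simp add: pos_def_def)
    then show ?thesis
      by (simp add: d uu)
  qed
  have det: "det A = (\<Prod>i\<in>UNIV. d i)"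
    by (subst A_eq) (rule frame_sum_det[OF u])
  define l where "l i = ln (d i)" for i
  \<comment> \<open>The projections lie on the boundary of the cone and are pushed inside by \<open>\<epsilon>\<close>.\<close>
  define v where "v \<epsilon> i = rank1 (u i) + \<epsilon> *\<^sub>R ?I" for \<epsilon> i
  define P where "P = (\<Sum>i\<in>UNIV. l i *\<^sub>R rank1 (u i))"
  define \<Lambda> where "\<Lambda> = (\<Sum>i\<in>UNIV. l i)"
  \<comment> \<open>The logarithmic derivative of \<open>g\<close> at I in the direction
    \<open>P\<close>, by centrality. For this \<open>L\<close> the tangent bound collapses to exp L
    * g(I).\<close>
  define L where "L = k * \<Lambda> / g ?I"
  have v_in: "v \<epsilon> i \<in> garding_cone g" if "0 < \<epsilon>" for \<epsilon> i
  proof -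
    have "(\<Sum>j\<in>UNIV. ((if j = i then 1 else 0) + \<epsilon>) *\<^sub>R rank1 (u j))
        = (\<Sum>j\<in>UNIV. (if j = i then 1 else 0) *\<^sub>R rank1 (u j)) + \<epsilon> *\<^sub>R (\<Sum>j\<in>UNIV. rank1 (u j))"
      by (simp only: scaleR_add_left sum.distrib scaleR_sum_right)
    also have "(\<Sum>j\<in>UNIV. (if j = i then 1 else 0) *\<^sub>R rank1 (u j)) = rank1 (u i)"
      by (simp add: if_distrib[of "\<lambda>c. c *\<^sub>R _"] cong: if_cong)
    finally have "v \<epsilon> i = (\<Sum>j\<in>UNIV. ((if j = i then 1 else 0) + \<epsilon>) *\<^sub>R rank1 (u j))"
      by (simp add: v_def frame_sum_one[OF u])
    moreover have "pos_def (\<Sum>j\<in>UNIV. ((if j = i then 1 else 0) + \<epsilon>) *\<^sub>R rank1 (u j))"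
      using that by (intro frame_sum_pos_def[OF u]) auto
    ultimately show ?thesis
      using sub by simp
  qed
  define R where "R \<epsilon> = exp L * (?f (\<Sum>i\<in>UNIV. v \<epsilon> i) * (1 - L) +
      (dderiv ?f P (\<Sum>i\<in>UNIV. v \<epsilon> i) + \<epsilon> * \<Lambda> * dderiv ?f ?I (\<Sum>i\<in>UNIV. v \<epsilon> i)))" for \<epsilon>
  have R_le: "R \<epsilon> \<le> ?f (\<Sum>i\<in>UNIV. d i *\<^sub>R v \<epsilon> i)" if "0 < \<epsilon>" for \<epsilon>
  proof -
    have "(\<Sum>i\<in>UNIV. l i *\<^sub>R v \<epsilon> i) = P + (\<epsilon> * \<Lambda>) *\<^sub>R ?I"
      by (simp add: v_def P_def \<Lambda>_def scaleR_add_right sum.distrib sum_distrib_left mult.commute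
          flip: scaleR_sum_left)
    moreover have "dderiv ?f (P + (\<epsilon> * \<Lambda>) *\<^sub>R ?I) x = dderiv ?f P x + \<epsilon> * \<Lambda> * dderiv ?f ?I x" for x
    proof -
      have lin: "linear (\<lambda>w. dderiv ?f w x)"
        using dderiv_has_derivative[OF poly] by (rule has_derivative_linear)
      show ?thesis
        by (simp add: linear_add[OF lin] linear_scale[OF lin])
    qed
    moreover have "(\<Sum>i\<in>UNIV. exp (l i) *\<^sub>R v \<epsilon> i) = (\<Sum>i\<in>UNIV. d i *\<^sub>R v \<epsilon> i)"
      using dpos by (simp add: l_def)
    ultimately show ?thesis
      using garding_exp_tangent[OF gard, where I = UNIV and v = "v \<epsilon>" and L = L and l = l]
        v_in[OF that] by (simp add: R_def)
  qed
  have contv: "continuous_on UNIV (\<lambda>\<epsilon>. v \<epsilon> i)" for i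
    unfolding v_def by (intro continuous_intros)
  have contp: "continuous_on UNIV (\<lambda>\<epsilon>. q (\<Sum>i\<in>UNIV. c i *\<^sub>R v \<epsilon> i))"
    if "real_polynomial_function q" for q :: "real^'n^'n \<Rightarrow> real" and c
    using that
    by (intro continuous_on_compose2[OF continuous_on_real_polynomial_function[of q UNIV]]
        continuous_intros contv) auto
  note contp1 = contp[of _ "\<lambda>i. 1", unfolded scaleR_one]
  \<comment> \<open>Both sides are continuous in \<epsilon>, so the inequality persists at
    \<epsilon> = 0, where the \<open>v \<epsilon> i\<close> become the projections, with sum
    I.\<close>
  have "closed {\<epsilon>. R \<epsilon> \<le> ?f (\<Sum>i\<in>UNIV. d i *\<^sub>R v \<epsilon> i)}"
    unfolding R_def using poly
    by (intro closed_Collect_le continuous_intros contp contp1 real_polynomial_function_dderiv)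
  then have "closure {0<..} \<subseteq> {\<epsilon>. R \<epsilon> \<le> ?f (\<Sum>i\<in>UNIV. d i *\<^sub>R v \<epsilon> i)}"
    using R_le by (intro closure_minimal) auto
  then have "R 0 \<le> ?f (\<Sum>i\<in>UNIV. d i *\<^sub>R v 0 i)"
    by auto
  moreover have "(\<Sum>i\<in>UNIV. d i *\<^sub>R v 0 i) = A"
    by (simp add: v_def A_eq)
  moreover have "R 0 = exp L * g ?I"
  proof -
    have "trace P = \<Lambda>"
      using trace_mult_sum_rank1[where D = "mat 1" and I = UNIV and a = l and u = u] by (simp add: P_def \<Lambda>_def uu)
    then have "R 0 = exp L * (g ?I * (1 - L) + k * \<Lambda>)"
      by (simp add: R_def v_def frame_sum_one[OF u] central_dderiv[OF hg k] sym_lift_eq mat_1_sym)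
    then show ?thesis
      using g1 by (simp add: L_def field_simps)
  qed
  moreover have "exp L = det A powr (real N / ?n)"
  proof -
    have "ln (det A) = \<Lambda>"
      unfolding det \<Lambda>_def l_def using dpos by (intro ln_prod) (auto simp: less_imp_neq[THEN not_sym])
    moreover have "0 < det A"
      unfolding det using dpos by (intro prod_pos) auto
    moreover have "k / g ?I = real N / ?n"
      using central_euler[OF hg k] g1 by (simp add: field_simps)
    ultimately show ?thesis
      by (simp add: L_def powr_def mult.commute)
         (metis times_divide_eq_left mult.commute)
  qed
  ultimately show ?thesis
    using A_sym by (simp add: sym_lift_eq mult.commute)
qed

section \<open>Gradients of the N-th root on the cone\<close>

theorem corollary1p7:
  fixes g :: "real^'n^'n \<Rightarrow> real" and N :: nat
  assumes "garding_dirichlet N g" and "I_central g"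
  shows "((\<forall>A. pos_def A \<longrightarrow>
              g A powr (1 / real N) \<ge>
                g (mat 1) powr (1 / real N) * det A powr (1 / real CARD('n)))
          \<longleftrightarrow>
          (\<forall>B\<in>garding_cone g. \<exists>D.
              has_sym_gradient (\<lambda>A. g A powr (1 / real N)) D B \<and> pos_def D \<and>
              det D \<ge> g (mat 1) powr (real CARD('n) / real N)
                        / real CARD('n) ^ CARD('n)))
       \<and> (\<forall>B\<in>garding_cone g. \<exists>D.
              has_sym_gradient (\<lambda>A. g A powr (1 / real N)) D B \<and> pos_def D \<and>
              det D \<ge> g (mat 1) powr (real CARD('n) / real N)
                        / real CARD('n) ^ CARD('n))"
proof -
  let ?n = "CARD('n)"
  obtain k where k: "0 < k" "has_sym_gradient g (k *\<^sub>R mat 1) (mat 1)"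
    using assms(2) by (auto simp: I_central_def)
  have hyp: "I_hyperbolic N g" and sub: "\<And>A. pos_def A \<Longrightarrow> A \<in> garding_cone g"
    using assms(1) by (auto simp: garding_dirichlet_def)
  then have hg: "homogeneous_polynomial N g" and g1: "0 < g (mat 1)"
    by (auto simp: I_hyperbolic_def)
  have N: "0 < N"
    using central_euler[OF hg k(2)] k(1) by (cases N) auto
  have P: "g (mat 1) powr (1 / real N) * det A powr (1 / real ?n) \<le> g A powr (1 / real N)"
    if A: "pos_def A" for A
  proof -
    have "(g (mat 1) * det A powr (real N / ?n)) powr (1 / real N) \<le> g A powr (1 / real N)"
      using det_majorization[OF assms(1) k(2) A] g1 by (intro powr_mono2) auto
    then show ?thesis
      using g1 N by (simp add: powr_mult powr_powr)
  qed
  have Q: "\<exists>D. has_sym_gradient (\<lambda>A. g A powr (1 / real N)) D B \<and> pos_def D \<and>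
      g (mat 1) powr (real ?n / real N) / real ?n ^ ?n \<le> det D"
    if B: "B \<in> garding_cone g" for B
  proof -
    have B_sym: "B \<in> sym_mats" and gB: "0 < g B"
      using B garding_cone_subset[of g] by auto
    obtain G where G: "has_sym_gradient g G B" "\<And>H. dderiv (sym_lift g) H B = trace (G ** H)"
      using sym_gradient_ex[OF hg B_sym] by blast
    \<comment> \<open>The chain-rule factor of the N-th root at g(B). It turns the lower bound in
      \<open>garding_inequality\<close> into exactly g(A)^(1/N).\<close>
    define c where "c = 1 / real N * g B powr (1 / real N - 1)"
    define D where "D = c *\<^sub>R G"
    have tr: "trace (D ** H) = c * trace (G ** H)" for H
      by (simp add: D_def trace_def matrix_matrix_mult_def sum_distrib_left mult_ac)
    have D_sym: "D \<in> sym_mats"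
      using G(1) by (simp add: D_def has_sym_gradient_def sym_mats_def transpose_scalar)
    have "has_sym_gradient (\<lambda>A. g A powr (1 / real N)) D B"
      unfolding has_sym_gradient_def
    proof (intro conjI B_sym D_sym)
      have "((\<lambda>z. z powr (1 / real N)) has_real_derivative c) (at (g B))"
        unfolding c_def using gB by (rule has_real_derivative_powr)
      moreover have "(g has_derivative (\<lambda>H. trace (G ** H))) (at B within sym_mats)"
        using G(1) by (simp add: has_sym_gradient_def)
      ultimately have "((\<lambda>A. g A powr (1 / real N)) has_derivative (\<lambda>H. trace (G ** H) * c))
          (at B within sym_mats)"
        by (rule DERIV_compose_FDERIV)
      then show "((\<lambda>A. g A powr (1 / real N)) has_derivative (\<lambda>H. trace (D ** H)))
          (at B within sym_mats)"
        by (simp add: tr mult.commute)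
    qed
    moreover have "g (mat 1) powr (1 / real N) * det A powr (1 / real ?n) \<le> trace (D ** A)"
      if A: "pos_def A" for A
    proof -
      have A_sym: "A \<in> sym_mats" and gA: "0 < g A"
        using sub[OF A] garding_cone_subset[of g] by auto
      have "real N * g B * (g A / g B) powr (1 / real N) \<le> trace (G ** A)"
        using garding_inequality[OF garding_on_sym_lift[OF hyp] N sub[OF A] B]
        by (simp add: sym_lift_eq A_sym B_sym G(2))
      then have "c * (real N * g B * (g A / g B) powr (1 / real N)) \<le> trace (D ** A)"
        unfolding tr by (intro mult_left_mono) (auto simp: c_def)
      moreover have "c * (real N * g B * (g A / g B) powr (1 / real N)) = g A powr (1 / real N)"
      proof -
        have "g B powr (1 / real N - 1) * g B = g B powr (1 / real N)"
          using gB by (simp add: powr_diff)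
        then show ?thesis
          using N gA gB by (simp add: c_def powr_divide field_simps)
      qed
      ultimately show ?thesis
        using P[OF A] by linarith
    qed
    then have "pos_def D \<and> (g (mat 1) powr (1 / real N)) ^ ?n / real ?n ^ ?n \<le> det D"
      using g1 by (intro pos_def_of_trace_bound[OF D_sym]) auto
    moreover have "(g (mat 1) powr (1 / real N)) ^ ?n = g (mat 1) powr (real ?n / real N)"
      using g1 by (simp add: powr_power)
    ultimately show ?thesis
      by auto
  qed
  \<comment> \<open>The determinant inequality \<open>P\<close> was used to derive \<open>Q\<close>;
    with both established, the equivalence and its second conjunct are immediate.\<close>
  from P Q show ?thesis
    by blast
qed

end
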